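(* Let $B$ be a Banach algebra over $\mathbf C$ and let $F$ and $G$ be $B$-valued analytic functions, each defined on a neighborhood of $0$ in $B$. Then $$\mathrm{mfs}(F+G)=\mathrm{mfs}(F)+\mathrm{mfs}(G),\qquad \mathrm{mfs}(FG)=\mathrm{mfs}(F)\cdot_s\mathrm{mfs}(G).$$ Moreover, if $G(0)=0$, then $$\mathrm{mfs}(F\circ G)=\mathrm{mfs}(F)\circ_s\mathrm{mfs}(G).$$ Furthermore, if $\mathrm{mfs}(F)$ is invertible with respect to symmetric multiplication or, respectively, symmetric composition in $\mathrm{SymMul}[[B]]$, then $F$ is invertible with respect to multiplication or, respectively, composition as a (germ at $0$ of a) $B$-valued analytic function.
   Context: $\widetilde B$ equals $B$ if $B$ has an identity element and its unitization otherwise. $\mathrm{Mul}[[B]]$ is the set of sequences $\alpha=(\alpha_0,\alpha_1,\ldots)$ with $\alpha_0\in\widetilde B$ and $\alpha_n:B^n\to B$ $n$-multilinear for $n\ge1$, with termwise addition, formal product $(\alpha\beta)_n(b_1,\ldots,b_n)=\sum_{k=0}^n\alpha_k(b_1,\ldots,b_k)\beta_{n-k}(b_{k+1},\ldots,b_n)$, and, when $\beta_0=0$, formal composition $(\alpha\circ\beta)_0=\alpha_0$, $$(\alpha\circ\beta)_n(b_1,\ldots,b_n)=\sum_{k=1}^n\ \sum_{\substack{p_1,\ldots,p_k\ge1 \\ p_1+\cdots+p_k=n}}\alpha_k\big(\beta_{p_1}(b_{q_1+1},\ldots,b_{q_1+p_1}),\ldots,\beta_{p_k}(b_{q_k+1},\ldots,b_{q_k+p_k})\big),\quad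 q_j=p_1+\cdots+p_{j-1}.$$ For $n$-multilinear $\alpha_n$, $(\mathrm{Sym}\,\alpha_n)(b_1,\ldots,b_n)=\frac1{n!}\sum_{\sigma\in S_n}\alpha_n(b_{\sigma(1)},\ldots,b_{\sigma(n)})$, and $\mathrm{Sym}\,\alpha=(\alpha_0,\alpha_1,\mathrm{Sym}\,\alpha_2,\mathrm{Sym}\,\alpha_3,\ldots)$. $\mathrm{SymMul}[[B]]=\{\mathrm{Sym}\,\alpha\mid\alpha\in\mathrm{Mul}[[B]]\}$. The symmetric product is $\alpha\cdot_s\beta=\mathrm{Sym}(\alpha\beta)$ with identity $1=(1,0,0,\ldots)$, and the symmetric composition (when $\beta_0=0$) is $\alpha\circ_s\beta=\mathrm{Sym}(\alpha\circ\beta)$ with identity $I=(0,\mathrm{id}_B,0,0,\ldots)$. If $F$ is a $B$-valued analytic function defined in a neighborhood of $0$ in $B$, its Taylor expansion is $F(b)=F(0)+\sum_{n=1}^\infty F_n(b,\ldots,b)$, where $F_n$ is the bounded symmetric $n$-multilinear function such that $n!F_n(h_1,\ldots,h_n)$ is the $n$-fold Fr\'echet derivative of $F$ at $0$ with increments $h_1,\ldots,h_n$. The multilinear function series of $F$ is $\mathrm{mfs}(F)=(F(0),F_1,F_2,\ldots)\in\mathrm{SymMul}[[B]]$. *)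

theory Defs
  imports "HOL-Analysis.Analysis" "HOL-Combinatorics.Permutations"
begin

section \<open>Complex Banach algebras, not necessarily unital\<close>

class complex_banach_algebra = real_normed_algebra + banach +
  fixes scaleC :: "complex \<Rightarrow> 'a \<Rightarrow> 'a"  (infixr \<open>*\<^sub>C\<close> 75)
  assumes scaleC_add_right: "c *\<^sub>C (x + y) = c *\<^sub>C x + c *\<^sub>C y"
    and scaleC_add_left: "(c + d) *\<^sub>C x = c *\<^sub>C x + d *\<^sub>C x"
    and scaleC_scaleC: "c *\<^sub>C d *\<^sub>C x = (c * d) *\<^sub>C x"
    and scaleC_of_real: "complex_of_real r *\<^sub>C x = r *\<^sub>R x"
    and norm_scaleC: "norm (c *\<^sub>C x) = cmod c * norm x"
    and mult_scaleC_left: "(c *\<^sub>C x) * y = c *\<^sub>C (x * y)"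
    and mult_scaleC_right: "x * (c *\<^sub>C y) = c *\<^sub>C (x * y)"

section \<open>The algebra $\widetilde B$\<close>

definition is_identity :: "'b::complex_banach_algebra \<Rightarrow> bool" where
  "is_identity e \<longleftrightarrow> (\<forall>b. e * b = b \<and> b * e = b)"

text \<open>Elements of $\widetilde B$ are pairs \<open>(b, z)\<close>, standing for $b + z1$. If \<open>B\<close> is not unital,
  all pairs are used and $\widetilde B$ is the unitization. If \<open>B\<close> has an identity \<open>e\<close>, only the pairs
  \<open>(b, 0)\<close> are used, so that $\widetilde B$ is \<open>B\<close> itself, with identity \<open>(e, 0)\<close>.\<close>

definition Btilde :: "('b::complex_banach_algebra \<times> complex) set" where
  "Btilde = (if \<exists>e::'b. is_identity e then {(b, z). z = 0} else UNIV)"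

definition Btilde_one :: "'b::complex_banach_algebra \<times> complex" where
  "Btilde_one = (if \<exists>e::'b. is_identity e then (THE e. is_identity e, 0) else (0, 1))"

definition Btilde_mult ::
    "'b::complex_banach_algebra \<times> complex \<Rightarrow> 'b \<times> complex \<Rightarrow> 'b \<times> complex"
    (infixl \<open>\<otimes>\<^sub>B\<close> 70) where
  "u \<otimes>\<^sub>B v = (fst u * fst v + snd u *\<^sub>C fst v + snd v *\<^sub>C fst u, snd u * snd v)"

definition of_B :: "'b::complex_banach_algebra \<Rightarrow> 'b \<times> complex" where
  "of_B b = (b, 0)"

section \<open>Multilinear function series\<close>

definition multilinear ::
    "nat \<Rightarrow> ('b::complex_banach_algebra list \<Rightarrow> 'b) \<Rightarrow> bool" where
  "multilinear n f \<longleftrightarrow> (\<forall>bs i x y c. length bs = n \<and> i < n \<longrightarrow>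
     f (bs[i := x + y]) = f (bs[i := x]) + f (bs[i := y]) \<and>
     f (bs[i := c *\<^sub>C x]) = c *\<^sub>C f (bs[i := x]))"

text \<open>A sequence $(\alpha_0, \alpha_1, \ldots)$ is a single function on lists:
  $\alpha_n(b_1, \ldots, b_n)$ is \<open>\<alpha> [b\<^sub>1, \<dots>, b\<^sub>n]\<close> and $\alpha_0$ is \<open>\<alpha> []\<close>. All values are taken in
  $\widetilde B$, and those with $n \ge 1$ are required to lie in the copy of \<open>B\<close>.\<close>

type_synonym 'b series = "'b list \<Rightarrow> 'b \<times> complex"

definition Mul :: "'b::complex_banach_algebra series set" where
  "Mul = {\<alpha>. \<alpha> [] \<in> Btilde \<and>
     (\<forall>n\<ge>1. (\<forall>bs. length bs = n \<longrightarrow> \<alpha> bs \<in> range of_B) \<and> multilinear n (\<lambda>bs. fst (\<alpha> bs)))}"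

definition series_add ::
    "'b::complex_banach_algebra series \<Rightarrow> 'b series \<Rightarrow> 'b series"  (infixl \<open>+\<^sub>f\<close> 65) where
  "\<alpha> +\<^sub>f \<beta> = (\<lambda>bs. \<alpha> bs + \<beta> bs)"

definition series_mult ::
    "'b::complex_banach_algebra series \<Rightarrow> 'b series \<Rightarrow> 'b series"  (infixl \<open>*\<^sub>f\<close> 70) where
  "\<alpha> *\<^sub>f \<beta> = (\<lambda>bs. \<Sum>k = 0..length bs. \<alpha> (take k bs) \<otimes>\<^sub>B \<beta> (drop k bs))"

definition compositions :: "nat \<Rightarrow> nat \<Rightarrow> nat list set" where
  "compositions n k = {ps. length ps = k \<and> (\<forall>p\<in>set ps. 1 \<le> p) \<and> sum_list ps = n}"

text \<open>With indices from \<open>0\<close>, the offset $q_j$ is \<open>sum_list (take j ps)\<close>.\<close>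

definition block :: "nat list \<Rightarrow> 'b list \<Rightarrow> nat \<Rightarrow> 'b list" where
  "block ps bs j = take (ps ! j) (drop (sum_list (take j ps)) bs)"

text \<open>Only meaningful when \<open>\<beta> [] = 0\<close>.\<close>

definition series_comp ::
    "'b::complex_banach_algebra series \<Rightarrow> 'b series \<Rightarrow> 'b series"  (infixl \<open>\<circ>\<^sub>f\<close> 55) where
  "\<alpha> \<circ>\<^sub>f \<beta> = (\<lambda>bs. if bs = [] then \<alpha> [] else
     (\<Sum>k = 1..length bs. \<Sum>ps\<in>compositions (length bs) k.
        \<alpha> (map (\<lambda>j. fst (\<beta> (block ps bs j))) [0..<k])))"

definition Sym :: "'b::complex_banach_algebra series \<Rightarrow> 'b series" where
  "Sym \<alpha> = (\<lambda>bs. (1 / fact (length bs)) *\<^sub>R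
     (\<Sum>\<sigma> | \<sigma> permutes {..<length bs}. \<alpha> (permute_list \<sigma> bs)))"

definition SymMul :: "'b::complex_banach_algebra series set" where
  "SymMul = Sym ` Mul"

definition sym_mult ::
    "'b::complex_banach_algebra series \<Rightarrow> 'b series \<Rightarrow> 'b series"  (infixl \<open>\<cdot>\<^sub>s\<close> 70) where
  "\<alpha> \<cdot>\<^sub>s \<beta> = Sym (\<alpha> *\<^sub>f \<beta>)"

definition sym_comp ::
    "'b::complex_banach_algebra series \<Rightarrow> 'b series \<Rightarrow> 'b series"  (infixl \<open>\<circ>\<^sub>s\<close> 55) where
  "\<alpha> \<circ>\<^sub>s \<beta> = Sym (\<alpha> \<circ>\<^sub>f \<beta>)"

definition series_one :: "'b::complex_banach_algebra series" where
  "series_one = (\<lambda>bs. if bs = [] then Btilde_one else 0)"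

definition series_id :: "'b::complex_banach_algebra series" where
  "series_id = (\<lambda>bs. if length bs = 1 then of_B (bs ! 0) else 0)"

definition sym_mult_invertible :: "'b::complex_banach_algebra series \<Rightarrow> bool" where
  "sym_mult_invertible \<alpha> \<longleftrightarrow>
     (\<exists>\<beta>\<in>SymMul. \<alpha> \<cdot>\<^sub>s \<beta> = series_one \<and> \<beta> \<cdot>\<^sub>s \<alpha> = series_one)"

definition sym_comp_invertible :: "'b::complex_banach_algebra series \<Rightarrow> bool" where
  "sym_comp_invertible \<alpha> \<longleftrightarrow> \<alpha> [] = 0 \<and>
     (\<exists>\<beta>\<in>SymMul. \<beta> [] = 0 \<and> \<alpha> \<circ>\<^sub>s \<beta> = series_id \<and> \<beta> \<circ>\<^sub>s \<alpha> = series_id)"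

section \<open>Analytic functions and their multilinear function series\<close>

definition symmetric_fn :: "nat \<Rightarrow> ('b list \<Rightarrow> 'b) \<Rightarrow> bool" where
  "symmetric_fn n f \<longleftrightarrow>
     (\<forall>bs \<sigma>. length bs = n \<and> \<sigma> permutes {..<n} \<longrightarrow> f (permute_list \<sigma> bs) = f bs)"

text \<open>Analyticity at a point is local expansion into a power series whose terms are bounded
  symmetric \<open>n\<close>-multilinear functions (over the complex numbers) and whose radius of convergence is
  positive, i.e. $\|c_n\| \le M r^{-n}$ for some $M$ and $r > 0$.\<close>

definition banach_analytic_at ::
    "('b::complex_banach_algebra \<Rightarrow> 'b) \<Rightarrow> 'b \<Rightarrow> bool" where
  "banach_analytic_at F a \<longleftrightarrow> (\<exists>c M r. 0 < r \<and>
     (\<forall>n. multilinear n c \<and> symmetric_fn n c) \<and>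
     (\<forall>hs. norm (c hs) \<le> M / r ^ length hs * prod_list (map norm hs)) \<and>
     (\<forall>h. norm h < r \<longrightarrow> (\<lambda>n. c (replicate n h)) sums F (a + h)))"

definition analytic_near_0 :: "('b::complex_banach_algebra \<Rightarrow> 'b) \<Rightarrow> bool" where
  "analytic_near_0 F \<longleftrightarrow> (\<exists>U. open U \<and> 0 \<in> U \<and> (\<forall>a\<in>U. banach_analytic_at F a))"

text \<open>\<open>fderiv F [h\<^sub>1, \<dots>, h\<^sub>n] x\<close> is the \<open>n\<close>-fold Frechet derivative of \<open>F\<close> at \<open>x\<close> with increments
  \<open>h\<^sub>1, \<dots>, h\<^sub>n\<close>. For complex differentiable functions the real Frechet derivative used here is the
  complex one.\<close>

fun fderiv :: "('b::real_normed_vector \<Rightarrow> 'b) \<Rightarrow> 'b list \<Rightarrow> 'b \<Rightarrow> 'b" where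
  "fderiv F [] x = F x"
| "fderiv F (h # hs) x = fderiv (\<lambda>y. frechet_derivative F (at y) h) hs x"

definition mfs :: "('b::complex_banach_algebra \<Rightarrow> 'b) \<Rightarrow> 'b series" where
  "mfs F = (\<lambda>hs. of_B ((1 / fact (length hs)) *\<^sub>R fderiv F hs 0))"

text \<open>The identity to be attained is that of $\widetilde B$; if \<open>B\<close> has no identity, no germ of a
  \<open>B\<close>-valued function is invertible.\<close>

definition germ_mult_invertible :: "('b::complex_banach_algebra \<Rightarrow> 'b) \<Rightarrow> bool" where
  "germ_mult_invertible F \<longleftrightarrow> (\<exists>H. analytic_near_0 H \<and>
     (\<forall>\<^sub>F b in nhds 0. of_B (F b * H b) = Btilde_one \<and> of_B (H b * F b) = Btilde_one))"

definition germ_comp_invertible :: "('b::complex_banach_algebra \<Rightarrow> 'b) \<Rightarrow> bool" where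
  "germ_comp_invertible F \<longleftrightarrow> F 0 = 0 \<and> (\<exists>H. analytic_near_0 H \<and> H 0 = 0 \<and>
     (\<forall>\<^sub>F b in nhds 0. F (H b) = b \<and> H (F b) = b))"

end

theory Submission imports Defs begin

text \<open>Write $c_n$ for the restriction of a function \<open>c\<close> on lists to lists of length $n$. The series
  $\sum_n c_n(h, \ldots, h)$ with bounds $\|c_n\| \le M r^{-n}$ behaves like a scalar power series,
  and the scalar arguments carry over once norms are used as majorants.

  Re-expanding such a series about a nearby point (\<open>power_series_recentre\<close>) shows at once that its
  sum is analytic near the centre and that its derivative in direction $h$ is again a power series,
  with coefficients $(n + 1)\, c_{n+1}(h, \cdot)$. Iterating, the $n$-fold derivative at the centre
  is $n!\, c_n$ when the $c_n$ are symmetric, so \<open>mfs\<close> reads off the symmetrized coefficients of any expansion whatsoever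
  (\<open>mfs_power_series\<close>). The identities for sums, products and composites are therefore reduced to
  producing one expansion of $F + G$, $F G$ and $F \circ G$, symmetric or not, and the formal
  operations provide them: the Cauchy product (\<open>power_series_mult\<close>), and substitution followed by a
  rearrangement of an absolutely convergent sum over all finite lists of positive integers
  (\<open>power_series_compose\<close>).

  For the converse direction a formal inverse $\beta$ is given, a series about whose convergence
  nothing is known. The equation that it satisfies is a recursion expressing $\beta_n$ through the
  $\beta_m$ with $m < n$, and the recursion forces geometric growth (\<open>formal_mult_inverse_bound\<close>,
  \<open>formal_comp_inverse_bound\<close>). Hence $\beta$ is the series of an analytic function $H$, and the
  product and composition rules show that $H$ inverts $F$, because the relevant expansion is the
  formal identity. For composition the recursion starts with $\beta_1$, the algebraic inverse of the
  bounded operator $F_1$; that it is bounded is the bounded inverse theorem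
  (\<open>linear_inverse_bounded\<close>), a consequence of Baire's theorem.\<close>

section \<open>Multilinear functions on lists\<close>

lemma multilinear_cong:
  assumes "\<And>bs. length bs = n \<Longrightarrow> f bs = g bs"
  shows "multilinear n f \<longleftrightarrow> multilinear n g"
  using assms by (simp add: multilinear_def)

text \<open>Since only one argument is varied at a time, multilinearity on a concatenation can be tested on
  the two halves separately. This is what makes products and block substitutions multilinear.\<close>

lemma multilinear_append:
  assumes "\<And>ys. length ys = q \<Longrightarrow> multilinear p (\<lambda>xs. f (xs @ ys))"
    and "\<And>xs. length xs = p \<Longrightarrow> multilinear q (\<lambda>ys. f (xs @ ys))"
  shows "multilinear (p + q) f"
  unfolding multilinear_def
proof (intro allI impI)
  fix bs :: "'a list" and i x y c
  assume bs: "length bs = p + q \<and> i < p + q"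
  define xs ys where "xs = take p bs" and "ys = drop p bs"
  have l: "length xs = p" "length ys = q" and eq: "bs = xs @ ys"
    using bs by (auto simp: xs_def ys_def)
  show "f (bs[i := x + y]) = f (bs[i := x]) + f (bs[i := y]) \<and>
     f (bs[i := c *\<^sub>C x]) = c *\<^sub>C f (bs[i := x])"
  proof (cases "i < p")
    case True
    then show ?thesis using assms(1)[OF l(2)] l unfolding multilinear_def eq
      by (simp add: list_update_append)
  next
    case False
    then have "i - p < q" using bs by auto
    then show ?thesis using assms(2)[OF l(1)] l False unfolding multilinear_def eq
      by (simp add: list_update_append)
  qed
qed

lemma multilinear_ConsD:
  assumes "multilinear (Suc n) f"
  shows "multilinear n (\<lambda>bs. f (b # bs))"
  unfolding multilinear_def
proof (intro allI impI)
  fix bs :: "'a list" and i x y c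
  assume bs: "length bs = n \<and> i < n"
  then have "length (b # bs) = Suc n \<and> Suc i < Suc n" by simp
  from assms[unfolded multilinear_def, rule_format, OF this]
  show "f (b # bs[i := x + y]) = f (b # bs[i := x]) + f (b # bs[i := y]) \<and>
     f (b # bs[i := c *\<^sub>C x]) = c *\<^sub>C f (b # bs[i := x])"
    by simp
qed

lemma multilinear_appendD:
  "multilinear (length as + n) f \<Longrightarrow> multilinear n (\<lambda>bs. f (as @ bs))"
proof (induction as arbitrary: f)
  case (Cons a as)
  from Cons.IH[OF multilinear_ConsD[of _ f a]] Cons.prems show ?case by simp
qed simp

lemma multilinear_Cons_add:
  assumes "multilinear (Suc (length bs)) f"
  shows "f ((x + y) # bs) = f (x # bs) + f (y # bs)"
  using assms[unfolded multilinear_def, rule_format, of "x # bs" 0] by simp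

lemma multilinear_Cons_scaleC:
  assumes "multilinear (Suc (length bs)) f"
  shows "f ((c *\<^sub>C x) # bs) = c *\<^sub>C f (x # bs)"
  using assms[unfolded multilinear_def, rule_format, of "x # bs" 0] by simp

lemma multilinear_Cons_scaleR:
  assumes "multilinear (Suc (length bs)) f"
  shows "f ((c *\<^sub>R x) # bs) = c *\<^sub>R f (x # bs)"
  using multilinear_Cons_scaleC[OF assms, of "complex_of_real c"] by (simp add: scaleC_of_real)

lemma scaleC_zero_right [simp]: "c *\<^sub>C (0::'a::complex_banach_algebra) = 0"
  using scaleC_add_right[of c "0::'a" 0] by simp

lemma scaleC_zero_left [simp]: "0 *\<^sub>C (x::'a::complex_banach_algebra) = 0"
  using scaleC_add_left[of 0 0 x] by simp

lemma scaleC_sum_right: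
  "c *\<^sub>C (\<Sum>i\<in>I. f i :: 'a::complex_banach_algebra) = (\<Sum>i\<in>I. c *\<^sub>C f i)"
  by (induction I rule: infinite_finite_induct) (auto simp: scaleC_add_right)

lemma scaleC_scaleR_commute:
  "c *\<^sub>C r *\<^sub>R (x::'a::complex_banach_algebra) = r *\<^sub>R c *\<^sub>C x"
  by (simp add: scaleC_of_real[symmetric] scaleC_scaleC mult.commute)

lemma bounded_linear_scaleC: "bounded_linear (\<lambda>x::'a::complex_banach_algebra. c *\<^sub>C x)"
  by (rule bounded_linear_intro[where K = "cmod c"])
    (auto simp: scaleC_add_right scaleC_scaleR_commute norm_scaleC)

lemma multilinear_compose_linear:
  assumes "multilinear n f" "\<And>x y. L (x + y) = L x + L y" "\<And>c x. L (c *\<^sub>C x) = c *\<^sub>C L x"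
  shows "multilinear n (\<lambda>bs. L (f bs))"
  using assms by (simp add: multilinear_def)

lemma multilinear_add:
  assumes "multilinear n f" "multilinear n g"
  shows "multilinear n (\<lambda>bs. f bs + g bs)"
  using assms by (simp add: multilinear_def scaleC_add_right algebra_simps)

lemma multilinear_scaleR:
  assumes "multilinear n f"
  shows "multilinear n (\<lambda>bs. r *\<^sub>R f bs)"
  using assms by (simp add: multilinear_def scaleC_scaleR_commute scaleR_add_right)

lemma multilinear_sum:
  assumes "\<And>i. i \<in> I \<Longrightarrow> multilinear n (f i)"
  shows "multilinear n (\<lambda>bs. \<Sum>i\<in>I. f i bs)"
  using assms by (simp add: multilinear_def scaleC_sum_right sum.distrib)

lemma multilinear_suminf:
  fixes f :: "nat \<Rightarrow> 'a::complex_banach_algebra list \<Rightarrow> 'a"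
  assumes "\<And>i. multilinear n (f i)" "\<And>bs. length bs = n \<Longrightarrow> summable (\<lambda>i. f i bs)"
  shows "multilinear n (\<lambda>bs. \<Sum>i. f i bs)"
  unfolding multilinear_def
proof (intro allI impI)
  fix bs :: "'a list" and j x y c
  assume bs: "length bs = n \<and> j < n"
  have eq: "f i (bs[j := x + y]) = f i (bs[j := x]) + f i (bs[j := y])"
    "f i (bs[j := c *\<^sub>C x]) = c *\<^sub>C f i (bs[j := x])" for i
    using assms(1)[of i] bs by (auto simp: multilinear_def)
  have s: "summable (\<lambda>i. f i (bs[j := z]))" for z using assms(2) bs by simp
  show "(\<Sum>i. f i (bs[j := x + y])) = (\<Sum>i. f i (bs[j := x])) + (\<Sum>i. f i (bs[j := y])) \<and>
     (\<Sum>i. f i (bs[j := c *\<^sub>C x])) = c *\<^sub>C (\<Sum>i. f i (bs[j := x]))"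
    unfolding eq using suminf_add[OF s s] bounded_linear.suminf[OF bounded_linear_scaleC s] by simp
qed

lemma multilinear_mult:
  assumes "multilinear p f" "multilinear q g"
  shows "multilinear (p + q) (\<lambda>bs. f (take p bs) * g (drop p bs))"
proof (rule multilinear_append)
  fix ys :: "'a list" assume "length ys = q"
  then show "multilinear p (\<lambda>xs. f (take p (xs @ ys)) * g (drop p (xs @ ys)))"
    using multilinear_compose_linear[OF assms(1), of "\<lambda>x. x * g ys"]
    by (subst multilinear_cong[where g = "\<lambda>xs. f xs * g ys"])
      (auto simp: algebra_simps mult_scaleC_left)
next
  fix xs :: "'a list" assume "length xs = p"
  then show "multilinear q (\<lambda>ys. f (take p (xs @ ys)) * g (drop p (xs @ ys)))"
    using multilinear_compose_linear[OF assms(2), of "\<lambda>x. f xs * x"]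
    by (simp add: algebra_simps mult_scaleC_right)
qed

text \<open>Recursive form of the consecutive blocks of \<open>bs\<close> of lengths \<open>ps\<close>, suited to induction on
  \<open>ps\<close>; the indexed form \<open>block\<close> computes offsets instead.\<close>

fun blocks :: "nat list \<Rightarrow> 'b list \<Rightarrow> 'b list list" where
  "blocks [] bs = []"
| "blocks (p # ps) bs = take p bs # blocks ps (drop p bs)"

lemma length_blocks [simp]: "length (blocks ps bs) = length ps"
  by (induction ps arbitrary: bs) auto

lemma map_block_eq_blocks: "map (\<lambda>j. d (block ps bs j)) [0..<length ps] = map d (blocks ps bs)"
proof (induction ps arbitrary: bs)
  case (Cons p ps)
  have "map (\<lambda>j. d (block (p # ps) bs j)) [0..<length (p # ps)]
      = d (take p bs) # map (\<lambda>j. d (block ps (drop p bs) j)) [0..<length ps]"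
    by (simp add: block_def upt_conv_Cons map_Suc_upt[symmetric] o_def add.commute
        del: upt_Suc map_Suc_upt)
  then show ?case using Cons by simp
qed simp

lemma multilinear_blocks:
  assumes "multilinear (length ps) c" "\<And>p. p \<in> set ps \<Longrightarrow> multilinear p d"
  shows "multilinear (sum_list ps) (\<lambda>bs. c (map d (blocks ps bs)))"
  using assms
proof (induction ps arbitrary: c)
  case Nil
  then show ?case by (simp add: multilinear_def)
next
  case (Cons p ps)
  have "multilinear (p + sum_list ps) (\<lambda>bs. c (d (take p bs) # map d (blocks ps (drop p bs))))"
  proof (rule multilinear_append)
    fix ys :: "'a list" assume ys: "length ys = sum_list ps"
    define zs where "zs = map d (blocks ps ys)"
    have l: "length zs = length ps" by (simp add: zs_def)
    have m: "multilinear (Suc (length zs)) c" using Cons.prems l by simp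
    have "multilinear p (\<lambda>xs. c (d xs # zs))"
      by (rule multilinear_compose_linear[where L = "\<lambda>x. c (x # zs)"])
        (use Cons.prems multilinear_Cons_add[OF m] multilinear_Cons_scaleC[OF m] in auto)
    then show "multilinear p
      (\<lambda>xs. c (d (take p (xs @ ys)) # map d (blocks ps (drop p (xs @ ys)))))"
      by (subst multilinear_cong[where g = "\<lambda>xs. c (d xs # zs)"]) (auto simp: zs_def)
  next
    fix xs :: "'a list" assume xs: "length xs = p"
    show "multilinear (sum_list ps)
      (\<lambda>ys. c (d (take p (xs @ ys)) # map d (blocks ps (drop p (xs @ ys)))))"
      using Cons.IH[of "\<lambda>zs. c (d xs # zs)"] Cons.prems multilinear_ConsD[of "length ps" c "d xs"] xs
      by simp
  qed
  then show ?case by simp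
qed

section \<open>Symmetrization\<close>

text \<open>\<open>Sym\<close> for series whose terms, including the constant one, all lie in the algebra itself.\<close>

definition symmetrize :: "('b list \<Rightarrow> 'b) \<Rightarrow> 'b list \<Rightarrow> 'b::real_vector" where
  "symmetrize f bs = (1 / fact (length bs)) *\<^sub>R
     (\<Sum>\<sigma> | \<sigma> permutes {..<length bs}. f (permute_list \<sigma> bs))"

lemma Sym_of_B: "Sym (\<lambda>bs. of_B (f bs)) = (\<lambda>bs. of_B (symmetrize f bs))"
  by (rule ext) (simp add: Sym_def symmetrize_def of_B_def prod_eq_iff fst_sum snd_sum)

lemma symmetrize_cong:
  assumes "\<And>cs. length cs = length bs \<Longrightarrow> f cs = g cs"
  shows "symmetrize f bs = symmetrize g bs"
  using assms by (simp add: symmetrize_def)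

lemma symmetrize_Nil [simp]: "symmetrize f [] = f []"
  by (simp add: symmetrize_def lessThan_0)

lemma symmetrize_invariant:
  assumes "\<And>\<sigma>. \<sigma> permutes {..<length bs} \<Longrightarrow> f (permute_list \<sigma> bs) = x"
  shows "symmetrize f bs = x"
proof -
  have "(\<Sum>\<sigma> | \<sigma> permutes {..<length bs}. f (permute_list \<sigma> bs))
      = (\<Sum>\<sigma> | \<sigma> permutes {..<length bs}. x)"
    using assms by (intro sum.cong) auto
  also have "\<dots> = fact (length bs) *\<^sub>R x"
    by (simp add: sum_constant_scaleR card_permutations del: sum_constant)
  finally show ?thesis
    by (simp add: symmetrize_def)
qed

lemma symmetrize_symmetric:
  assumes "symmetric_fn (length bs) f"
  shows "symmetrize f bs = f bs"
  using assms unfolding symmetric_fn_def by (intro symmetrize_invariant) blast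

lemma permute_list_replicate:
  assumes "\<sigma> permutes {..<n}"
  shows "permute_list \<sigma> (replicate n h) = replicate n h"
proof (rule nth_equalityI)
  fix i assume "i < length (permute_list \<sigma> (replicate n h))"
  then show "permute_list \<sigma> (replicate n h) ! i = replicate n h ! i"
    using permutes_in_image[OF assms, of i] by (simp add: permute_list_def)
qed simp

text \<open>A power series only sees the diagonal values of its coefficients, so symmetrizing the
  coefficients does not change its sum.\<close>

lemma symmetrize_replicate: "symmetrize f (replicate n h) = f (replicate n h)"
  by (rule symmetrize_invariant) (simp add: permute_list_replicate)

lemma symmetrize_add: "symmetrize (\<lambda>bs. f bs + g bs) bs = symmetrize f bs + symmetrize g bs"
  unfolding symmetrize_def sum.distrib scaleR_add_right ..

lemma symmetrize_linear:
  assumes "linear L"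
  shows "L (symmetrize f bs) = symmetrize (\<lambda>bs. L (f bs)) bs"
  unfolding symmetrize_def linear_scale[OF assms] linear_sum[OF assms] ..

lemma prod_norm_permute_list:
  assumes "\<sigma> permutes {..<length bs}"
  shows "prod_list (map norm (permute_list \<sigma> bs)) = (prod_list (map norm bs) :: real)"
proof -
  have "mset (map norm (permute_list \<sigma> bs)) = mset (map norm bs)"
    using mset_permute_list[OF assms] by simp
  then show ?thesis
    by (metis prod_mset_prod_list)
qed

lemma symmetrize_norm_le:
  fixes f :: "'b::real_normed_vector list \<Rightarrow> 'b"
  assumes "\<And>cs. length cs = length bs \<Longrightarrow> norm (f cs) \<le> K * prod_list (map norm cs)"
  shows "norm (symmetrize f bs) \<le> K * prod_list (map norm bs)"
proof -
  have "norm (\<Sum>\<sigma> | \<sigma> permutes {..<length bs}. f (permute_list \<sigma> bs))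
      \<le> (\<Sum>\<sigma> | \<sigma> permutes {..<length bs}. K * prod_list (map norm bs))"
  proof (rule sum_norm_le)
    fix \<sigma> assume "\<sigma> \<in> {\<sigma>. \<sigma> permutes {..<length bs}}"
    then show "norm (f (permute_list \<sigma> bs)) \<le> K * prod_list (map norm bs)"
      using assms[of "permute_list \<sigma> bs"] by (simp add: prod_norm_permute_list)
  qed
  also have "\<dots> = fact (length bs) * (K * prod_list (map norm bs))"
    by (simp add: card_permutations[of _ "length bs"])
  finally show ?thesis
    by (simp add: symmetrize_def field_simps)
qed

lemma symmetric_symmetrize: "symmetric_fn n (symmetrize f)"
  unfolding symmetric_fn_def
proof (intro allI impI)
  fix bs :: "'a list" and \<sigma> assume a: "length bs = n \<and> \<sigma> permutes {..<n}"
  have "(\<Sum>\<tau> | \<tau> permutes {..<n}. f (permute_list \<tau> (permute_list \<sigma> bs)))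
      = (\<Sum>\<tau> | \<tau> permutes {..<n}. f (permute_list (\<sigma> \<circ> \<tau>) bs))"
    using a by (intro sum.cong) (auto simp: permute_list_compose)
  also have "\<dots> = (\<Sum>\<tau> | \<tau> permutes {..<n}. f (permute_list \<tau> bs))"
    using setum_permutations_compose_left[of \<sigma> "{..<n}" "\<lambda>\<tau>. f (permute_list \<tau> bs)"] a
    by simp
  finally show "symmetrize f (permute_list \<sigma> bs) = symmetrize f bs"
    using a by (simp add: symmetrize_def)
qed

lemma permute_list_update:
  assumes "\<sigma> permutes {..<length bs}" "i < length bs"
  shows "permute_list \<sigma> (bs[i := x]) = (permute_list \<sigma> bs)[inv \<sigma> i := x]"
proof (rule nth_equalityI)
  fix j assume "j < length (permute_list \<sigma> (bs[i := x]))"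
  then have j: "j < length bs" by simp
  have "\<sigma> j < length bs" using permutes_in_image[OF assms(1), of j] j by simp
  moreover have "inv \<sigma> i = j \<longleftrightarrow> i = \<sigma> j" using permutes_inv_eq[OF assms(1)] by auto
  moreover have "inv \<sigma> i < length bs"
    using permutes_in_image[OF permutes_inv[OF assms(1)], of i] assms(2) by simp
  ultimately show "permute_list \<sigma> (bs[i := x]) ! j = (permute_list \<sigma> bs)[inv \<sigma> i := x] ! j"
    using j by (auto simp: permute_list_def nth_list_update)
qed simp

lemma multilinear_symmetrize:
  assumes "multilinear n f"
  shows "multilinear n (symmetrize f)"
proof -
  have "multilinear n (\<lambda>bs. f (permute_list \<sigma> bs))" if "\<sigma> permutes {..<n}" for \<sigma>
    unfolding multilinear_def
  proof (intro allI impI)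
    fix bs :: "'a list" and i x y c
    assume a: "length bs = n \<and> i < n"
    have "inv \<sigma> i < n" using permutes_in_image[OF permutes_inv[OF that], of i] a by simp
    then show "f (permute_list \<sigma> (bs[i := x + y])) = f (permute_list \<sigma> (bs[i := x])) + f (permute_list \<sigma> (bs[i := y])) \<and>
     f (permute_list \<sigma> (bs[i := c *\<^sub>C x])) = c *\<^sub>C f (permute_list \<sigma> (bs[i := x]))"
      using assms a that by (simp add: permute_list_update multilinear_def)
  qed
  then have "multilinear n
      (\<lambda>bs. (1 / fact n) *\<^sub>R (\<Sum>\<sigma> | \<sigma> permutes {..<n}. f (permute_list \<sigma> bs)))"
    by (intro multilinear_scaleR multilinear_sum) auto
  then show ?thesis
    by (subst multilinear_cong) (auto simp: symmetrize_def)
qed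

lemma symmetric_fn_mset_cong:
  assumes "symmetric_fn (length xs) f" "mset xs = mset ys"
  shows "f xs = f ys"
proof -
  obtain \<sigma> where "\<sigma> permutes {..<length ys}" "permute_list \<sigma> ys = xs"
    using mset_eq_permutation[OF assms(2)] by auto
  then show ?thesis
    using assms mset_eq_length[OF assms(2)] by (auto simp: symmetric_fn_def)
qed

lemma symmetric_fnI:
  assumes "\<And>xs ys. length xs = n \<Longrightarrow> mset xs = mset ys \<Longrightarrow> f xs = f ys"
  shows "symmetric_fn n f"
  unfolding symmetric_fn_def
proof (intro allI impI)
  fix bs :: "'a list" and \<sigma> assume "length bs = n \<and> \<sigma> permutes {..<n}"
  then show "f (permute_list \<sigma> bs) = f bs"
    by (intro assms) auto
qed

section \<open>Power series with multilinear coefficients\<close>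

text \<open>An unconditional sum may be grouped along the fibres of a degree function. Reading the same sum
  along two degree functions is how series are rearranged below.\<close>

lemma has_sum_fibres_imp_sums:
  fixes f :: "'i \<Rightarrow> 'a::banach" and g :: "'i \<Rightarrow> nat"
  assumes "(f has_sum S) I" "\<And>n. (f has_sum F n) {i \<in> I. g i = n}"
  shows "F sums S"
proof -
  have "bij_betw snd (SIGMA n:UNIV. {i \<in> I. g i = n}) I"
    by (rule bij_betwI[where g = "\<lambda>i. (g i, i)"]) auto
  from has_sum_reindex_bij_betw[OF this, of f S] assms(1)
  have "((\<lambda>x. f (snd x)) has_sum S) (SIGMA n:UNIV. {i \<in> I. g i = n})" by simp
  then have "(F has_sum S) UNIV"
    by (rule has_sum_SigmaD) (use assms(2) in simp)
  then show ?thesis by (rule has_sum_imp_sums)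
qed

lemma abs_summable_on_fibres:
  fixes f :: "'i \<Rightarrow> 'a::banach" and g :: "'i \<Rightarrow> nat"
  assumes "\<And>n. finite {i \<in> I. g i = n}"
    and bound: "\<And>n. (\<Sum>i | i \<in> I \<and> g i = n. norm (f i)) \<le> a n" and "summable a"
  shows "f abs_summable_on I"
  unfolding abs_summable_iff_bdd_above
proof (rule bdd_aboveI2)
  fix X assume "X \<in> {X. X \<subseteq> I \<and> finite X}"
  then have X: "X \<subseteq> I" "finite X" by auto
  have a: "0 \<le> a n" for n using bound[of n] by (meson norm_ge_zero order_trans sum_nonneg)
  have "(\<Sum>i\<in>X. norm (f i)) = (\<Sum>n\<in>g ` X. \<Sum>i | i \<in> X \<and> g i = n. norm (f i))"
    by (rule sum.image_gen[OF X(2)])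
  also have "\<dots> \<le> (\<Sum>n\<in>g ` X. a n)"
  proof (rule sum_mono)
    fix n
    have "(\<Sum>i | i \<in> X \<and> g i = n. norm (f i)) \<le> (\<Sum>i | i \<in> I \<and> g i = n. norm (f i))"
      using X assms(1) by (intro sum_mono2) auto
    then show "(\<Sum>i | i \<in> X \<and> g i = n. norm (f i)) \<le> a n" using bound[of n] by linarith
  qed
  also have "\<dots> \<le> suminf a"
    using X a assms(3) by (intro sum_le_suminf) auto
  finally show "(\<Sum>i\<in>X. norm (f i)) \<le> suminf a" .
qed

lemma prod_list_nonneg_real:
  fixes xs :: "real list"
  assumes "\<And>x. x \<in> set xs \<Longrightarrow> 0 \<le> x"
  shows "0 \<le> prod_list xs"
  using assms by (induction xs) auto

lemma prod_norm_nonneg: "0 \<le> prod_list (map norm hs)"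
  by (rule prod_list_nonneg_real) auto

text \<open>The data of an analytic germ at \<open>a\<close>, but with coefficients that need not be symmetric: products and
  composites come with non-symmetric coefficients, and symmetrizing is postponed.\<close>

definition power_series ::
    "('b::complex_banach_algebra \<Rightarrow> 'b) \<Rightarrow> 'b \<Rightarrow> ('b list \<Rightarrow> 'b) \<Rightarrow> real \<Rightarrow> real \<Rightarrow> bool" where
  "power_series F a c M r \<longleftrightarrow> 0 < r \<and> (\<forall>n. multilinear n c) \<and>
     (\<forall>hs. norm (c hs) \<le> M / r ^ length hs * prod_list (map norm hs)) \<and>
     (\<forall>h. norm h < r \<longrightarrow> (\<lambda>n. c (replicate n h)) sums F (a + h))"

lemma banach_analytic_at_iff:
  "banach_analytic_at F a \<longleftrightarrow> (\<exists>c M r. power_series F a c M r \<and> (\<forall>n. symmetric_fn n c))"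
  unfolding banach_analytic_at_def power_series_def by blast

lemma power_series_symmetrize:
  assumes "power_series F a c M r"
  shows "power_series F a (symmetrize c) M r"
  unfolding power_series_def symmetrize_replicate
proof (intro conjI allI)
  fix hs
  show "norm (symmetrize c hs) \<le> M / r ^ length hs * prod_list (map norm hs)"
  proof (rule symmetrize_norm_le)
    fix cs :: "'a list" assume "length cs = length hs"
    then show "norm (c cs) \<le> M / r ^ length hs * prod_list (map norm cs)"
      using assms unfolding power_series_def by metis
  qed
qed (use assms in \<open>auto simp: power_series_def intro!: multilinear_symmetrize\<close>)

lemma banach_analytic_atI: "power_series F a c M r \<Longrightarrow> banach_analytic_at F a"
  unfolding banach_analytic_at_iff using power_series_symmetrize symmetric_symmetrize by blast

lemma prod_norm_replicate [simp]: "prod_list (map norm (replicate n h)) = norm h ^ n"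
  by (simp add: prod_list_replicate)

context
  fixes F :: "'b::complex_banach_algebra \<Rightarrow> 'b" and a c M r
  assumes ps: "power_series F a c M r"
begin

lemma power_series_radius_pos: "0 < r"
  and power_series_multilinear: "multilinear n c"
  and power_series_norm_le: "norm (c hs) \<le> M / r ^ length hs * prod_list (map norm hs)"
  and power_series_sums: "norm h < r \<Longrightarrow> (\<lambda>n. c (replicate n h)) sums F (a + h)"
  using ps by (auto simp: power_series_def)

lemma power_series_const_nonneg: "0 \<le> M"
  using order_trans[OF norm_ge_zero power_series_norm_le[of "[]"]] by simp

lemma power_series_coeff_Nil: "c [] = F a"
proof -
  have "norm (c (replicate n 0)) \<le> 0" if "n \<noteq> 0" for n
    using power_series_norm_le[of "replicate n 0"] that by (simp add: zero_power)
  then have "(\<lambda>n. c (replicate n 0)) sums (\<Sum>n\<in>{0}. c (replicate n 0))"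
    by (intro sums_finite) auto
  moreover have "(\<lambda>n. c (replicate n 0)) sums F a"
    using power_series_sums[of 0] power_series_radius_pos by simp
  ultimately show ?thesis by (simp add: sums_unique2)
qed

lemma power_series_term_norm_le: "norm (c (replicate n h)) \<le> M * (norm h / r) ^ n"
  using power_series_norm_le[of "replicate n h"] by (simp add: power_divide)

lemma power_series_norm_summable:
  assumes "norm h < r"
  shows "summable (\<lambda>n. norm (c (replicate n h)))"
proof (rule summable_comparison_test)
  show "\<exists>N. \<forall>n\<ge>N. norm (norm (c (replicate n h))) \<le> M * (norm h / r) ^ n"
    using power_series_term_norm_le by auto
  show "summable (\<lambda>n. M * (norm h / r) ^ n)"
    using assms power_series_radius_pos by (intro summable_mult summable_geometric) auto
qed

lemma power_series_linear_term: "bounded_linear (\<lambda>h. c [h])"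
proof (rule bounded_linear_intro[where K = "M / r"])
  have m: "multilinear (Suc (length [])) c" for bs :: "'b list" using power_series_multilinear .
  show "c [x + y] = c [x] + c [y]" "c [s *\<^sub>R x] = s *\<^sub>R c [x]" for x y s
    using multilinear_Cons_add[OF m] multilinear_Cons_scaleR[OF m] by auto
  show "norm (c [x]) \<le> norm x * (M / r)" for x
    using power_series_norm_le[of "[x]"] by (simp add: mult.commute)
qed

text \<open>For $\|h\| < r/2$ the terms of degree at least 2 add up to at most $2 M (\|h\|/r)^2$.\<close>

lemma power_series_has_derivative: "(F has_derivative (\<lambda>h. c [h])) (at a)"
  unfolding has_derivative_at
proof (intro conjI power_series_linear_term)
  have "norm (norm (F (a + h) - F a - c [h]) / norm h) \<le> (2 * M / r\<^sup>2) * norm h"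
    if h: "h \<noteq> 0" "norm h < r / 2" for h
  proof -
    define q where "q = norm h / r"
    have q: "0 \<le> q" "q < 1 / 2" using h power_series_radius_pos by (auto simp: q_def field_simps)
    have hr: "norm h < r" using h power_series_radius_pos by simp
    have "(\<lambda>n. c (replicate (n + 2) h)) sums (F (a + h) - (\<Sum>n<2. c (replicate n h)))"
      using sums_split_initial_segment[OF power_series_sums[OF hr], of 2] .
    moreover have "(\<Sum>n<2. c (replicate n h)) = F a + c [h]"
      by (simp add: eval_nat_numeral power_series_coeff_Nil)
    ultimately have s: "(\<lambda>n. c (replicate (n + 2) h)) sums (F (a + h) - F a - c [h])"
      by (simp add: algebra_simps)
    have "norm (F (a + h) - F a - c [h]) = norm (\<Sum>n. c (replicate (n + 2) h))"
      using sums_unique[OF s] by simp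
    also have "\<dots> \<le> (\<Sum>n. M * q\<^sup>2 * q ^ n)"
    proof (rule norm_suminf_le)
      show "norm (c (replicate (n + 2) h)) \<le> M * q\<^sup>2 * q ^ n" for n
        using power_series_term_norm_le[of "n + 2" h] by (simp add: q_def power2_eq_square mult_ac)
      show "summable (\<lambda>n. M * q\<^sup>2 * q ^ n)" using q by (intro summable_mult summable_geometric) auto
    qed
    also have "\<dots> = M * q\<^sup>2 * (1 / (1 - q))"
      using q by (subst suminf_mult) (auto simp: suminf_geometric)
    also have "\<dots> \<le> M * q\<^sup>2 * 2"
      using q power_series_const_nonneg by (intro mult_left_mono) (auto simp: field_simps)
    also have "\<dots> = (2 * M / r\<^sup>2) * norm h * norm h"
      by (simp add: q_def power2_eq_square)
    finally show ?thesis using h by (simp add: field_simps)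
  qed
  then have "\<forall>\<^sub>F h in at 0.
      norm (norm (F (a + h) - F a - c [h]) / norm h) \<le> (2 * M / r\<^sup>2) * norm h"
    unfolding eventually_at using power_series_radius_pos
    by (intro exI[of _ "r / 2"]) auto
  moreover have "((\<lambda>h. (2 * M / r\<^sup>2) * norm h) \<longlongrightarrow> 0) (at (0::'b))"
    by (rule tendsto_mult_right_zero) (rule tendsto_norm_zero, rule tendsto_ident_at)
  ultimately show "(\<lambda>h. norm (F (a + h) - F a - c [h]) / norm h) \<midarrow>0\<rightarrow> 0"
    by (rule Lim_null_comparison)
qed

end

section \<open>Change of centre and derivatives\<close>

lemma multilinear_binomial:
  assumes "multilinear n f" "symmetric_fn n f"
  shows "f (replicate n (x + y))
    = (\<Sum>k\<le>n. real (n choose k) *\<^sub>R f (replicate (n - k) x @ replicate k y))"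
  using assms
proof (induction n arbitrary: f)
  case (Suc n)
  have sym: "symmetric_fn n (\<lambda>bs. f (z # bs))" for z
  proof (rule symmetric_fnI)
    fix xs ys :: "'a list" assume "length xs = n" "mset xs = mset ys"
    then show "f (z # xs) = f (z # ys)"
      using Suc.prems(2) by (intro symmetric_fn_mset_cong) auto
  qed
  note IH = Suc.IH[OF multilinear_ConsD[OF Suc.prems(1)] sym]
  let ?t = "\<lambda>k. f (replicate (Suc n - k) x @ replicate k y)"
  have x: "f (x # replicate (n - k) x @ replicate k y) = ?t k" if "k \<le> n" for k
    using that by (simp add: Suc_diff_le)
  have y: "f (y # replicate (n - k) x @ replicate k y) = ?t (Suc k)" if "k \<le> n" for k
    using that Suc.prems(2) by (intro symmetric_fn_mset_cong) auto
  have "f (replicate (Suc n) (x + y)) = f (x # replicate n (x + y)) + f (y # replicate n (x + y))"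
    using multilinear_Cons_add[of "replicate n (x + y)" f x y] Suc.prems(1) by simp
  also have "\<dots> = (\<Sum>k\<le>n. real (n choose k) *\<^sub>R ?t k) + (\<Sum>k\<le>n. real (n choose k) *\<^sub>R ?t (Suc k))"
    unfolding IH using x y by (intro arg_cong2[of _ _ _ _ "(+)"] sum.cong) auto
  also have "(\<Sum>k\<le>n. real (n choose k) *\<^sub>R ?t k) = (\<Sum>k\<le>Suc n. real (n choose k) *\<^sub>R ?t k)"
    by simp
  also have "\<dots> = ?t 0 + (\<Sum>k\<le>n. real (n choose Suc k) *\<^sub>R ?t (Suc k))"
    by (subst sum.atMost_Suc_shift) simp
  also have "?t 0 + (\<Sum>k\<le>n. real (n choose Suc k) *\<^sub>R ?t (Suc k)) + (\<Sum>k\<le>n. real (n choose k) *\<^sub>R ?t (Suc k))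
      = ?t 0 + (\<Sum>k\<le>n. real (Suc n choose Suc k) *\<^sub>R ?t (Suc k))"
    by (simp add: sum.distrib scaleR_add_left add.commute)
  also have "\<dots> = (\<Sum>k\<le>Suc n. real (Suc n choose k) *\<^sub>R ?t k)"
    by (subst sum.atMost_Suc_shift) simp
  finally show ?case .
qed simp

text \<open>The coefficients at a point displaced by \<open>b\<close>: in the binomial expansion of
  $c_n(b + h, \ldots, b + h)$, collect the terms with a fixed number of arguments $h$.\<close>

definition recentre :: "'b \<Rightarrow> ('b list \<Rightarrow> 'b) \<Rightarrow> 'b list \<Rightarrow> 'b::complex_banach_algebra" where
  "recentre b c hs = (\<Sum>m. real ((m + length hs) choose m) *\<^sub>R c (replicate m b @ hs))"

text \<open>The double family of terms $\binom{m+k}{m}\, c_{m+k}(b^m, h^k)$ is absolutely summable, since its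
  diagonal $m + k = n$ is bounded by $M ((\|b\| + \|h\|)/r)^n$. Summed along diagonals it gives the
  value at $b + h$, summed along columns the new series in $h$. With $\|b\| < r/4$ the crude estimate
  $\binom{m+k}{m} \le 2^{m+k}$ leaves a factor $2^{-m}$ and hence half of the radius.\<close>

lemma power_series_recentre:
  assumes ps: "power_series F a c M r" and sym: "\<And>n. symmetric_fn n c" and b: "norm b < r / 4"
  shows "power_series F (a + b) (recentre b c) (2 * M) (r / 2)"
    and "\<And>n. symmetric_fn n (recentre b c)"
    and "summable (\<lambda>m. real ((m + length hs) choose m) *\<^sub>R c (replicate m b @ hs))"
proof -
  note r = power_series_radius_pos[OF ps] and M = power_series_const_nonneg[OF ps]
  define t where "t = (\<lambda>hs m. real ((m + length hs) choose m) *\<^sub>R c (replicate m b @ hs))"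
  have t_le: "norm (t hs m) \<le> M / (r / 2) ^ length hs * prod_list (map norm hs) * (1 / 2) ^ m" for hs m
  proof -
    let ?k = "length hs"
    have p: "0 \<le> prod_list (map norm hs)" by (rule prod_norm_nonneg)
    have "norm (t hs m) = real ((m + ?k) choose m) * norm (c (replicate m b @ hs))"
      by (simp add: t_def)
    also have "\<dots> \<le> 2 ^ (m + ?k) * (M / r ^ (m + ?k) * (norm b ^ m * prod_list (map norm hs)))"
    proof (rule mult_mono)
      have "(m + ?k) choose m \<le> 2 ^ (m + ?k)" by (rule binomial_le_pow2)
      then show "real ((m + ?k) choose m) \<le> 2 ^ (m + ?k)"
        by (metis of_nat_le_iff of_nat_numeral of_nat_power)
      show "norm (c (replicate m b @ hs)) \<le> M / r ^ (m + ?k) * (norm b ^ m * prod_list (map norm hs))"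
        using power_series_norm_le[OF ps, of "replicate m b @ hs"] by (simp add: prod_list_replicate)
    qed auto
    also have "\<dots> = M / (r / 2) ^ ?k * prod_list (map norm hs) * (2 * norm b / r) ^ m"
      by (simp add: power_add power_mult_distrib power_divide field_simps)
    also have "\<dots> \<le> M / (r / 2) ^ ?k * prod_list (map norm hs) * (1 / 2) ^ m"
      using b r M p by (intro mult_left_mono power_mono) (auto simp: field_simps)
    finally show ?thesis .
  qed
  have gs: "summable (\<lambda>m. K * (1 / 2 :: real) ^ m)" for K
    by (intro summable_mult summable_geometric) auto
  have ns: "summable (\<lambda>m. norm (t hs m))" for hs
  proof (rule summable_comparison_test'[OF gs, where N = 0])
    show "norm (norm (t hs m)) \<le> M / (r / 2) ^ length hs * prod_list (map norm hs) * (1 / 2) ^ m" for m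
      unfolding real_norm_def abs_norm_cancel by (rule t_le)
  qed
  have st: "summable (t hs)" for hs
    using summable_norm_cancel[OF ns] .
  then show "summable (\<lambda>m. real ((m + length hs) choose m) *\<^sub>R c (replicate m b @ hs))"
    by (simp add: t_def)
  have rec: "recentre b c hs = suminf (t hs)" for hs by (simp add: recentre_def t_def)
  show "symmetric_fn n (recentre b c)" for n
  proof (rule symmetric_fnI)
    fix xs ys :: "'a list" assume "mset xs = mset ys"
    then have "c (replicate m b @ xs) = c (replicate m b @ ys)" "length xs = length ys" for m
      using sym by (auto intro!: symmetric_fn_mset_cong dest: mset_eq_length)
    then show "recentre b c xs = recentre b c ys" by (simp add: recentre_def)
  qed
  have ml: "multilinear n (recentre b c)" for n
  proof -
    have "multilinear n (\<lambda>hs. \<Sum>m. real ((m + n) choose m) *\<^sub>R c (replicate m b @ hs))"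
    proof (rule multilinear_suminf)
      show "multilinear n (\<lambda>hs. real ((m + n) choose m) *\<^sub>R c (replicate m b @ hs))" for m
        using multilinear_appendD[of "replicate m b" n c] power_series_multilinear[OF ps]
        by (intro multilinear_scaleR) simp
      show "summable (\<lambda>m. real ((m + n) choose m) *\<^sub>R c (replicate m b @ hs))"
        if "length hs = n" for hs using st[of hs] that by (simp add: t_def)
    qed
    then show ?thesis by (subst multilinear_cong) (auto simp: recentre_def)
  qed
  have bd: "norm (recentre b c hs) \<le> 2 * M / (r / 2) ^ length hs * prod_list (map norm hs)" for hs
  proof -
    have "norm (suminf (t hs)) \<le> (\<Sum>m. M / (r / 2) ^ length hs * prod_list (map norm hs) * (1 / 2) ^ m)"
      by (rule norm_suminf_le[OF t_le gs])
    also have "\<dots> = M / (r / 2) ^ length hs * prod_list (map norm hs) * 2"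
      by (subst suminf_mult) (auto simp: suminf_geometric)
    finally show ?thesis by (simp add: rec mult_ac)
  qed
  have sums: "(\<lambda>k. recentre b c (replicate k h)) sums F (a + b + h)" if h: "norm h < r / 2" for h
  proof -
    \<comment> \<open>\<open>f\<close> is the double family; \<open>m\<close> counts the arguments \<open>b\<close> and \<open>k\<close> the arguments \<open>h\<close>.\<close>
    define f where "f = (\<lambda>(m, k). t (replicate k h) m)"
    have fib: "{i \<in> UNIV. fst i + snd i = n} = (\<lambda>k. (n - k, k)) ` {..n}" for n :: nat
      by (auto simp: image_iff)
    have inj: "inj_on (\<lambda>k. (n - k, k)) {..n}" for n :: nat by (auto simp: inj_on_def)
    have fin: "finite {i \<in> UNIV. fst i + snd i = n}" for n :: nat unfolding fib by simp
    have diag: "sum g {i \<in> UNIV. fst i + snd i = n} = (\<Sum>k\<le>n. g (n - k, k))"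
      for g :: "nat \<times> nat \<Rightarrow> 'z::comm_monoid_add" and n
      unfolding fib using sum.reindex[OF inj, of g] by (simp add: o_def)
    have bh: "norm b + norm h < r" using b h r by simp
    have f_le: "norm (f (n - k, k)) \<le> real (n choose k) * (M / r ^ n * (norm b ^ (n - k) * norm h ^ k))"
      if "k \<le> n" for n k
    proof -
      have "norm (f (n - k, k)) = real (n choose k) * norm (c (replicate (n - k) b @ replicate k h))"
        using that binomial_symmetric[OF that] by (simp add: f_def t_def)
      also have "\<dots> \<le> real (n choose k) * (M / r ^ n * (norm b ^ (n - k) * norm h ^ k))"
        using power_series_norm_le[OF ps, of "replicate (n - k) b @ replicate k h"] that
        by (intro mult_left_mono) auto
      finally show ?thesis .
    qed
    have "f abs_summable_on UNIV"
    proof (rule abs_summable_on_fibres[OF fin])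
      fix n
      have "(\<Sum>i | i \<in> UNIV \<and> fst i + snd i = n. norm (f i)) = (\<Sum>k\<le>n. norm (f (n - k, k)))"
        by (rule diag)
      also have "\<dots> \<le> (\<Sum>k\<le>n. real (n choose k) * (M / r ^ n * (norm b ^ (n - k) * norm h ^ k)))"
        using f_le by (intro sum_mono) auto
      also have "\<dots> = M * ((norm h + norm b) / r) ^ n"
        by (simp add: binomial_ring power_divide sum_distrib_left sum_divide_distrib mult_ac)
      finally show "(\<Sum>i | i \<in> UNIV \<and> fst i + snd i = n. norm (f i)) \<le> M * ((norm h + norm b) / r) ^ n" .
    next
      show "summable (\<lambda>n. M * ((norm h + norm b) / r) ^ n)"
        using bh r by (intro summable_mult summable_geometric) (auto simp: add.commute)
    qed
    then obtain S where S: "(f has_sum S) UNIV"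
      using abs_summable_summable summable_on_def by blast
    have "(\<lambda>n. c (replicate n (b + h))) sums S"
    proof (rule has_sum_fibres_imp_sums[OF S])
      fix n
      have "c (replicate n (b + h)) = (\<Sum>k\<le>n. f (n - k, k))"
        unfolding multilinear_binomial[OF power_series_multilinear[OF ps] sym]
        by (intro sum.cong) (auto simp: f_def t_def binomial_symmetric[symmetric])
      then show "(f has_sum c (replicate n (b + h))) {i \<in> UNIV. fst i + snd i = n}"
        by (intro has_sum_finiteI fin) (simp only: diag)
    qed
    moreover have "(\<lambda>n. c (replicate n (b + h))) sums F (a + (b + h))"
      by (rule power_series_sums[OF ps]) (use bh norm_triangle_ineq[of b h] in linarith)
    ultimately have "S = F (a + b + h)" using sums_unique2 by (metis add.assoc)
    moreover have "(\<lambda>k. recentre b c (replicate k h)) sums S"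
    proof (rule has_sum_fibres_imp_sums[OF S])
      fix k
      have hs: "(t (replicate k h) has_sum recentre b c (replicate k h)) UNIV"
        unfolding rec by (intro norm_summable_imp_has_sum summable_sums st ns)
      have bij: "bij_betw (\<lambda>m. (m, k)) UNIV {i \<in> UNIV. snd i = k}"
        by (rule bij_betwI[where g = fst]) auto
      have "(\<lambda>m. f (m, k)) = t (replicate k h)" by (simp add: f_def)
      then show "(f has_sum recentre b c (replicate k h)) {i \<in> UNIV. snd i = k}"
        using has_sum_reindex_bij_betw[OF bij, of f] hs by simp
    qed
    ultimately show ?thesis by simp
  qed
  show "power_series F (a + b) (recentre b c) (2 * M) (r / 2)"
    unfolding power_series_def using r ml bd sums by simp
qed

lemma power_series_imp_analytic_near_0:
  assumes "power_series F 0 c M r"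
  shows "analytic_near_0 F"
  unfolding analytic_near_0_def
proof (intro exI conjI ballI)
  note ps = power_series_symmetrize[OF assms]
  show "open (ball (0::'a) (r / 4))" "0 \<in> ball (0::'a) (r / 4)"
    using power_series_radius_pos[OF ps] by auto
  fix a :: 'a assume "a \<in> ball 0 (r / 4)"
  then show "banach_analytic_at F a"
    using banach_analytic_atI[OF power_series_recentre(1)[OF ps symmetric_symmetrize]] by simp
qed

text \<open>By induction on the list of increments: the derivative in direction \<open>h\<close> at a nearby point \<open>y\<close> is the
  linear coefficient of the series recentred at \<open>y\<close>, and as a function of \<open>y\<close> this is a power series
  with coefficients $(n + 1)\, c_{n+1}(h, \cdot)$ on a ball of a quarter of the radius. The factor
  $n + 1 \le 4^n$ is absorbed by that loss of radius.\<close>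

lemma fderiv_power_series:
  assumes "power_series F 0 c M r" "\<And>n. symmetric_fn n c"
  shows "fderiv F hs 0 = fact (length hs) *\<^sub>R c hs"
  using assms
proof (induction hs arbitrary: F c M r)
  case Nil
  then show ?case by (simp add: power_series_coeff_Nil)
next
  case (Cons h hs)
  note ps = Cons.prems(1) and sym = Cons.prems(2)
  note r = power_series_radius_pos[OF ps] and M = power_series_const_nonneg[OF ps]
  define d where "d = (\<lambda>hs. real (Suc (length hs)) *\<^sub>R c (h # hs))"
  have "power_series (\<lambda>y. frechet_derivative F (at y) h) 0 d (M * norm h / r) (r / 4)"
    unfolding power_series_def
  proof (intro conjI allI impI)
    show "0 < r / 4" using r by simp
    fix n
    have "multilinear n (\<lambda>hs. real (Suc n) *\<^sub>R c (h # hs))"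
      by (intro multilinear_scaleR multilinear_ConsD power_series_multilinear[OF ps])
    then show "multilinear n d"
      by (subst multilinear_cong) (auto simp: d_def)
  next
    fix hs :: "'a list"
    have p: "0 \<le> prod_list (map norm hs)" by (rule prod_norm_nonneg)
    have "Suc n \<le> 4 ^ n" for n by (induction n) auto
    from this[of "length hs"] have 4: "real (Suc (length hs)) \<le> 4 ^ length hs"
      by (metis of_nat_le_iff of_nat_numeral of_nat_power)
    have "norm (d hs) = real (Suc (length hs)) * norm (c (h # hs))" by (simp add: d_def)
    also have "\<dots> \<le> 4 ^ length hs * (M / r ^ Suc (length hs) * (norm h * prod_list (map norm hs)))"
      using power_series_norm_le[OF ps, of "h # hs"] by (intro mult_mono 4) auto
    also have "\<dots> = M * norm h / r / (r / 4) ^ length hs * prod_list (map norm hs)"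
      by (simp add: power_divide)
    finally show "norm (d hs) \<le> M * norm h / r / (r / 4) ^ length hs * prod_list (map norm hs)" .
  next
    fix y :: 'a assume y: "norm y < r / 4"
    note rec = power_series_recentre[OF ps sym y]
    have "frechet_derivative F (at y) h = recentre y c [h]"
      using fun_cong[OF frechet_derivative_at[OF power_series_has_derivative[OF rec(1)]], of h]
      by simp
    moreover have "(\<lambda>m. real ((m + length [h]) choose m) *\<^sub>R c (replicate m y @ [h])) sums recentre y c [h]"
      unfolding recentre_def by (rule summable_sums) (rule rec(3))
    moreover have "c (replicate m y @ [h]) = c (h # replicate m y)" for m
      by (intro symmetric_fn_mset_cong sym) simp
    ultimately show "(\<lambda>n. d (replicate n y)) sums frechet_derivative F (at (0 + y)) h"
      by (simp add: d_def)
  qed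
  moreover have "symmetric_fn n d" for n
  proof (rule symmetric_fnI)
    fix xs ys :: "'a list" assume "mset xs = mset ys"
    then have "c (h # xs) = c (h # ys)" "length xs = length ys"
      using sym by (auto intro!: symmetric_fn_mset_cong dest: mset_eq_length)
    then show "d xs = d ys" by (simp add: d_def)
  qed
  ultimately have "fderiv (\<lambda>y. frechet_derivative F (at y) h) hs 0 = fact (length hs) *\<^sub>R d hs"
    by (rule Cons.IH)
  then show ?case by (simp add: d_def mult.commute)
qed

text \<open>Uniqueness of Taylor coefficients up to symmetrization.\<close>

lemma mfs_power_series:
  assumes "power_series F 0 c M r"
  shows "mfs F = (\<lambda>hs. of_B (symmetrize c hs))"
  unfolding mfs_def fderiv_power_series[OF power_series_symmetrize[OF assms] symmetric_symmetrize]
  by simp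

section \<open>Sums and products\<close>

lemma power_series_shrink:
  assumes ps: "power_series F a c M r" and s: "0 < s" "s \<le> r"
  shows "power_series F a c M s"
  unfolding power_series_def
proof (intro conjI allI impI)
  fix hs :: "'a list"
  have "M / r ^ length hs \<le> M / s ^ length hs"
    using s power_series_const_nonneg[OF ps] by (intro divide_left_mono power_mono) auto
  from mult_right_mono[OF this prod_norm_nonneg[of hs]]
  show "norm (c hs) \<le> M / s ^ length hs * prod_list (map norm hs)"
    using power_series_norm_le[OF ps, of hs] by linarith
qed (use assms in \<open>auto intro: power_series_multilinear power_series_sums\<close>)

lemma power_series_add:
  assumes F: "power_series F a c M r" and G: "power_series G a d N s"
  shows "power_series (\<lambda>x. F x + G x) a (\<lambda>hs. c hs + d hs) (M + N) (min r s)"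
proof -
  have m: "0 < min r s" using power_series_radius_pos[OF F] power_series_radius_pos[OF G] by simp
  note F' = power_series_shrink[OF F m] and G' = power_series_shrink[OF G m]
  show ?thesis unfolding power_series_def
  proof (intro conjI allI impI m)
    fix hs :: "'a list"
    show "norm (c hs + d hs) \<le> (M + N) / min r s ^ length hs * prod_list (map norm hs)"
      using norm_triangle_le[OF add_mono[OF power_series_norm_le[OF F', of hs] power_series_norm_le[OF G', of hs]]]
      by (simp add: add_divide_distrib distrib_right)
  next
    fix h :: 'a assume "norm h < min r s"
    then show "(\<lambda>n. c (replicate n h) + d (replicate n h)) sums (F (a + h) + G (a + h))"
      by (intro sums_add power_series_sums[OF F'] power_series_sums[OF G']) auto
  next
    show "multilinear n (\<lambda>hs. c hs + d hs)" for n
      by (intro multilinear_add power_series_multilinear[OF F] power_series_multilinear[OF G])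
  qed
qed

definition formal_mult :: "('b list \<Rightarrow> 'b) \<Rightarrow> ('b list \<Rightarrow> 'b) \<Rightarrow> 'b list \<Rightarrow> 'b::real_normed_algebra" where
  "formal_mult c d hs = (\<Sum>k\<le>length hs. c (take k hs) * d (drop k hs))"

lemma prod_norm_take_drop:
  "prod_list (map norm (take k hs)) * prod_list (map norm (drop k hs)) = prod_list (map norm hs)"
  by (metis append_take_drop_id map_append prod_list.append)

lemma norm_mult_split_le:
  fixes c d :: "'b::real_normed_algebra list \<Rightarrow> 'b"
  assumes "norm (c (take k hs)) \<le> A * prod_list (map norm (take k hs))"
    and "norm (d (drop k hs)) \<le> B * prod_list (map norm (drop k hs))"
  shows "norm (c (take k hs) * d (drop k hs)) \<le> A * B * prod_list (map norm hs)"
proof -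
  have "norm (c (take k hs) * d (drop k hs)) \<le> norm (c (take k hs)) * norm (d (drop k hs))"
    by (rule norm_mult_ineq)
  also have "\<dots> \<le> (A * prod_list (map norm (take k hs))) * (B * prod_list (map norm (drop k hs)))"
    by (rule mult_mono[OF assms]) (use order_trans[OF norm_ge_zero assms(1)] in auto)
  also have "\<dots> = A * B * (prod_list (map norm (take k hs)) * prod_list (map norm (drop k hs)))"
    by (simp only: mult_ac)
  finally show ?thesis by (simp only: prod_norm_take_drop)
qed

lemma multilinear_formal_mult:
  assumes "\<And>n. multilinear n c" "\<And>n. multilinear n d"
  shows "multilinear n (formal_mult c d)"
proof -
  have "multilinear n (\<lambda>hs. \<Sum>k\<le>n. c (take k hs) * d (drop k hs))"
  proof (rule multilinear_sum)
    fix k assume "k \<in> {..n}"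
    then show "multilinear n (\<lambda>hs. c (take k hs) * d (drop k hs))"
      using multilinear_mult[of k c "n - k" d] assms by simp
  qed
  then show ?thesis by (subst multilinear_cong) (auto simp: formal_mult_def)
qed

text \<open>The coefficient of degree $n$ consists of $n + 1 \le 2^n$ products, which costs half of the radius.\<close>

lemma power_series_mult:
  assumes F: "power_series F a c M r" and G: "power_series G a d N s"
  shows "power_series (\<lambda>x. F x * G x) a (formal_mult c d) (M * N) (min r s / 2)"
proof -
  define m where "m = min r s"
  have m: "0 < m" "m \<le> r" "m \<le> s"
    using power_series_radius_pos[OF F] power_series_radius_pos[OF G] by (auto simp: m_def)
  note F' = power_series_shrink[OF F m(1,2)] and G' = power_series_shrink[OF G m(1,3)]
  have MN: "0 \<le> M" "0 \<le> N" using power_series_const_nonneg[OF F] power_series_const_nonneg[OF G] by auto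
  have "power_series (\<lambda>x. F x * G x) a (formal_mult c d) (M * N) (m / 2)"
    unfolding power_series_def
  proof (intro conjI allI impI multilinear_formal_mult power_series_multilinear[OF F] power_series_multilinear[OF G])
    show "0 < m / 2" using m by simp
    fix hs :: "'a list"
    let ?n = "length hs"
    have "norm (formal_mult c d hs) \<le> (\<Sum>k\<le>?n. M * N / m ^ ?n * prod_list (map norm hs))"
      unfolding formal_mult_def
    proof (rule sum_norm_le)
      fix k assume k: "k \<in> {..?n}"
      have "norm (c (take k hs) * d (drop k hs)) \<le> (M / m ^ k) * (N / m ^ (?n - k)) * prod_list (map norm hs)"
        using power_series_norm_le[OF F', of "take k hs"] power_series_norm_le[OF G', of "drop k hs"] k
        by (intro norm_mult_split_le) (auto simp: min_absorb2)
      also have "(M / m ^ k) * (N / m ^ (?n - k)) = M * N / m ^ ?n"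
        using k by (simp add: power_add[symmetric])
      finally show "norm (c (take k hs) * d (drop k hs)) \<le> M * N / m ^ ?n * prod_list (map norm hs)" .
    qed
    also have "\<dots> = real (Suc ?n) * (M * N / m ^ ?n * prod_list (map norm hs))"
      by simp
    also have "\<dots> \<le> 2 ^ ?n * (M * N / m ^ ?n * prod_list (map norm hs))"
    proof (rule mult_right_mono)
      have "Suc ?n \<le> 2 ^ ?n" by (induction hs) auto
      then show "real (Suc ?n) \<le> 2 ^ ?n" by (metis of_nat_le_iff of_nat_numeral of_nat_power)
      show "0 \<le> M * N / m ^ ?n * prod_list (map norm hs)"
        using MN m prod_norm_nonneg[of hs] by simp
    qed
    also have "\<dots> = M * N / (m / 2) ^ ?n * prod_list (map norm hs)"
      by (simp add: power_divide)
    finally show "norm (formal_mult c d hs) \<le> M * N / (m / 2) ^ length hs * prod_list (map norm hs)" .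
  next
    fix h :: 'a assume "norm h < m / 2"
    then have h: "norm h < m" using m by simp
    have "formal_mult c d (replicate n h) = (\<Sum>k\<le>n. c (replicate k h) * d (replicate (n - k) h))" for n
      unfolding formal_mult_def by (intro sum.cong) (auto simp: min_absorb1)
    moreover have "F (a + h) = (\<Sum>n. c (replicate n h))" "G (a + h) = (\<Sum>n. d (replicate n h))"
      using power_series_sums[OF F' h] power_series_sums[OF G' h] by (auto simp: sums_iff)
    ultimately show "(\<lambda>n. formal_mult c d (replicate n h)) sums (F (a + h) * G (a + h))"
      using Cauchy_product_sums[OF power_series_norm_summable[OF F' h] power_series_norm_summable[OF G' h]]
      by simp
  qed
  then show ?thesis by (simp add: m_def)
qed

section \<open>Composition\<close>

text \<open>Expanding a power of a sum by distributivity.\<close>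

lemma sum_prod_list_lists:
  fixes w :: "'i \<Rightarrow> 'a::comm_semiring_1"
  assumes "finite A"
  shows "(\<Sum>ps | set ps \<subseteq> A \<and> length ps = k. prod_list (map w ps)) = (\<Sum>p\<in>A. w p) ^ k"
proof (induction k)
  case (Suc k)
  have "(\<Sum>ps | set ps \<subseteq> A \<and> length ps = Suc k. prod_list (map w ps))
      = (\<Sum>x\<in>A \<times> {ps. set ps \<subseteq> A \<and> length ps = k}. w (fst x) * prod_list (map w (snd x)))"
    by (rule sum.reindex_bij_witness[where j = "\<lambda>ps. (hd ps, tl ps)" and i = "\<lambda>(p, ps). p # ps"])
      (auto simp: length_Suc_conv)
  also have "\<dots> = (\<Sum>p\<in>A. w p) * (\<Sum>ps | set ps \<subseteq> A \<and> length ps = k. prod_list (map w ps))"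
    by (simp add: sum_product sum.cartesian_product split_def)
  finally show ?case using Suc by simp
next
  case 0
  have "{ps. set ps \<subseteq> A \<and> length ps = 0} = {[]}" by auto
  then show ?case by simp
qed

lemma sum_prod_list_length_le:
  fixes w :: "nat \<Rightarrow> real"
  assumes w: "\<And>p. 1 \<le> p \<Longrightarrow> 0 \<le> w p" and W: "\<And>n. (\<Sum>p=1..n. w p) \<le> W"
    and X: "finite X" "\<And>ps. ps \<in> X \<Longrightarrow> 0 \<notin> set ps \<and> length ps = k"
  shows "(\<Sum>ps\<in>X. prod_list (map w ps)) \<le> W ^ k"
proof -
  obtain m where m: "\<And>ps p. ps \<in> X \<Longrightarrow> p \<in> set ps \<Longrightarrow> p \<le> m"
  proof
    fix ps p assume "ps \<in> X" "p \<in> set ps"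
    then show "p \<le> Max (\<Union> (set ` X))" using X(1) by (intro Max_ge) auto
  qed
  have sub: "X \<subseteq> {ps. set ps \<subseteq> {1..m} \<and> length ps = k}"
    using m X(2) by (auto simp: Suc_le_eq intro!: gr0I)
  have pos: "0 \<le> prod_list (map w ps)" if "set ps \<subseteq> {1..m}" for ps
    using that w by (intro prod_list_nonneg_real) auto
  have "(\<Sum>ps\<in>X. prod_list (map w ps)) \<le> (\<Sum>ps | set ps \<subseteq> {1..m} \<and> length ps = k. prod_list (map w ps))"
    by (intro sum_mono2 sub finite_lists_length_eq) (auto intro!: pos)
  also have "\<dots> = (\<Sum>p=1..m. w p) ^ k" by (rule sum_prod_list_lists) simp
  also have "\<dots> \<le> W ^ k" using W w by (intro power_mono sum_nonneg) auto
  finally show ?thesis .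
qed

text \<open>The scalar majorant behind composition: grouping lists by their length \<open>k\<close> bounds the sum by
  $\sum_{k \ge l} W^k$. The cut-off \<open>l\<close> matters for the compositional inverse, where the terms
  of length at least 2 have to be small of second order.\<close>

lemma sum_prod_list_le:
  fixes w :: "nat \<Rightarrow> real"
  assumes w: "\<And>p. 1 \<le> p \<Longrightarrow> 0 \<le> w p" and W: "\<And>n. (\<Sum>p=1..n. w p) \<le> W" "W < 1"
    and X: "finite X" "\<And>ps. ps \<in> X \<Longrightarrow> 0 \<notin> set ps \<and> l \<le> length ps"
  shows "(\<Sum>ps\<in>X. prod_list (map w ps)) \<le> W ^ l / (1 - W)"
proof -
  have W0: "0 \<le> W" using W(1)[of 0] by simp
  have s: "summable (\<lambda>k. W ^ l * W ^ k)" using W0 W(2) by (intro summable_mult summable_geometric) auto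
  have "(\<Sum>ps\<in>X. prod_list (map w ps))
      = (\<Sum>k\<in>(\<lambda>ps. length ps - l) ` X. \<Sum>ps | ps \<in> X \<and> length ps - l = k. prod_list (map w ps))"
    by (rule sum.image_gen[OF X(1)])
  also have "\<dots> \<le> (\<Sum>k\<in>(\<lambda>ps. length ps - l) ` X. W ^ l * W ^ k)"
  proof (rule sum_mono)
    fix k
    have "length ps = l + k" if "ps \<in> X" "length ps - l = k" for ps
      using X(2)[OF that(1)] that(2) by linarith
    then show "(\<Sum>ps | ps \<in> X \<and> length ps - l = k. prod_list (map w ps)) \<le> W ^ l * W ^ k"
      unfolding power_add[symmetric] using X by (intro sum_prod_list_length_le w W(1)) auto
  qed
  also have "\<dots> \<le> (\<Sum>k. W ^ l * W ^ k)" using X(1) W0 by (intro sum_le_suminf s) auto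
  also have "\<dots> = W ^ l / (1 - W)"
    using W0 W(2) by (subst suminf_mult) (auto simp: suminf_geometric)
  finally show ?thesis .
qed

lemma norm_multilinear_map_le:
  assumes "\<And>hs. length hs = k \<Longrightarrow> norm (c hs) \<le> K * prod_list (map norm hs)" "length ps = k"
  shows "norm (c (map u ps)) \<le> K * prod_list (map (\<lambda>p. norm (u p)) ps)"
  using assms(1)[of "map u ps"] assms(2) by (simp add: o_def)

lemma multilinear_lists_summable:
  fixes u :: "nat \<Rightarrow> 'b::complex_banach_algebra"
  assumes c: "\<And>hs. length hs = k \<Longrightarrow> norm (c hs) \<le> K * prod_list (map norm hs)"
    and W: "\<And>n. (\<Sum>p=1..n. norm (u p)) \<le> W" and K: "0 \<le> K"
  shows "(\<lambda>ps. c (map u ps) :: 'b) summable_on {ps. length ps = k \<and> 0 \<notin> set ps}"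
proof (rule abs_summable_summable, unfold abs_summable_iff_bdd_above, rule bdd_aboveI2)
  fix X :: "nat list set" assume "X \<in> {X. X \<subseteq> {ps. length ps = k \<and> 0 \<notin> set ps} \<and> finite X}"
  then have X: "finite X" "\<And>ps. ps \<in> X \<Longrightarrow> 0 \<notin> set ps \<and> length ps = k" by auto
  have "(\<Sum>ps\<in>X. norm (c (map u ps))) \<le> (\<Sum>ps\<in>X. K * prod_list (map (\<lambda>p. norm (u p)) ps))"
    using X(2) by (intro sum_mono norm_multilinear_map_le[OF c]) auto
  also have "\<dots> \<le> K * W ^ k"
    unfolding sum_distrib_left[symmetric]
    by (intro mult_left_mono K sum_prod_list_length_le X W) auto
  finally show "(\<Sum>ps\<in>X. norm (c (map u ps))) \<le> K * W ^ k" .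
qed

text \<open>Expansion of $c(y, \ldots, y)$ with $y = \sum_p u_p$ into all terms $c(u_{p_1}, \ldots, u_{p_k})$,
  one argument at a time.\<close>

lemma multilinear_lists_has_sum:
  fixes u :: "nat \<Rightarrow> 'b::complex_banach_algebra"
  assumes "multilinear k c"
    and "\<And>hs. length hs = k \<Longrightarrow> norm (c hs) \<le> K * prod_list (map norm hs)" "0 \<le> K"
    and W: "\<And>n. (\<Sum>p=1..n. norm (u p)) \<le> W" and y: "(u has_sum y) {1..}"
  shows "((\<lambda>ps. c (map u ps) :: 'b) has_sum c (replicate k y)) {ps. length ps = k \<and> 0 \<notin> set ps}"
  using assms(1-3)
proof (induction k arbitrary: c K)
  case 0
  have "{ps :: nat list. length ps = 0 \<and> 0 \<notin> set ps} = {[]}" by auto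
  then show ?case by (simp add: has_sum_finiteI)
next
  case (Suc k)
  let ?L = "\<lambda>k. {ps :: nat list. length ps = k \<and> 0 \<notin> set ps}"
  have bij: "bij_betw (\<lambda>(p, ps). p # ps) ({1..} \<times> ?L k) (?L (Suc k))"
    by (rule bij_betwI[where g = "\<lambda>ps. (hd ps, tl ps)"]) (auto simp: length_Suc_conv Suc_le_eq)
  have "((\<lambda>x. c (map u (case x of (p, ps) \<Rightarrow> p # ps))) has_sum c (replicate (Suc k) y)) ({1..} \<times> ?L k)"
  proof (rule has_sum_SigmaI)
    fix p
    have "((\<lambda>ps. c (u p # map u ps)) has_sum c (u p # replicate k y)) (?L k)"
    proof (rule Suc.IH[OF multilinear_ConsD[OF Suc.prems(1)]])
      show "norm (c (u p # hs)) \<le> K * norm (u p) * prod_list (map norm hs)" if "length hs = k" for hs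
        using Suc.prems(2)[of "u p # hs"] that by (simp add: mult_ac)
    qed (use Suc.prems(3) in simp)
    then show "((\<lambda>ps. c (map u (case (p, ps) of (p, ps) \<Rightarrow> p # ps))) has_sum c (u p # replicate k y)) (?L k)"
      by simp
  next
    have m: "multilinear (Suc (length (replicate k y))) c" using Suc.prems(1) by simp
    have "bounded_linear (\<lambda>x. c (x # replicate k y))"
    proof (rule bounded_linear_intro)
      show "norm (c (x # replicate k y)) \<le> norm x * (K * norm y ^ k)" for x
        using Suc.prems(2)[of "x # replicate k y"] by (simp add: mult_ac prod_list_replicate)
    qed (use multilinear_Cons_add[OF m] multilinear_Cons_scaleR[OF m] in auto)
    from has_sum_bounded_linear[OF this y]
    show "((\<lambda>p. c (u p # replicate k y)) has_sum c (replicate (Suc k) y)) {1..}" by simp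
  next
    show "(\<lambda>x. c (map u (case x of (p, ps) \<Rightarrow> p # ps))) summable_on ({1..} \<times> ?L k)"
      using summable_on_reindex_bij_betw[OF bij, of "\<lambda>ps. c (map u ps)"]
        multilinear_lists_summable[OF Suc.prems(2) W Suc.prems(3)] by simp
  qed
  then show ?case
    using has_sum_reindex_bij_betw[OF bij, of "\<lambda>ps. c (map u ps)"] by simp
qed

text \<open>Compositions of \<open>n\<close> with any number of parts.\<close>

definition compositions_of :: "nat \<Rightarrow> nat list set" where
  "compositions_of n = {ps. 0 \<notin> set ps \<and> sum_list ps = n}"

lemma length_le_sum_list: "0 \<notin> set ps \<Longrightarrow> length ps \<le> sum_list (ps :: nat list)"
  by (induction ps) auto

lemma finite_compositions_of: "finite (compositions_of n)"
proof (rule finite_subset)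
  show "compositions_of n \<subseteq> {ps. set ps \<subseteq> {..n} \<and> length ps \<le> n}"
    using length_le_sum_list member_le_sum_list by (fastforce simp: compositions_of_def)
qed (rule finite_lists_length_le, simp)

lemma compositions_of_0 [simp]: "compositions_of 0 = {[]}"
  by (auto simp: compositions_of_def) (metis neq_Nil_conv list.set_intros(1))

text \<open>The single part \<open>n\<close> is separated because it yields the only term of a formal composition in which
  the top coefficient of the inner series occurs.\<close>

lemma compositions_of_eq_insert:
  assumes "0 < n"
  shows "compositions_of n = insert [n] {ps \<in> compositions_of n. 2 \<le> length ps}"
proof -
  have "ps = [n]" if "sum_list ps = n" "\<not> 2 \<le> length ps" for ps
    using that assms by (cases ps; cases "tl ps") auto
  then show ?thesis using assms by (auto simp: compositions_of_def)
qed

lemma sum_compositions_of: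
  assumes "0 < n"
  shows "sum f (compositions_of n) = (\<Sum>k=1..n. sum f (compositions n k))"
proof -
  have "sum f (compositions_of n)
      = (\<Sum>k\<in>{1..n}. sum f {ps. ps \<in> compositions_of n \<and> length ps = k})"
  proof (rule sum.group[symmetric])
    show "length ` compositions_of n \<subseteq> {1..n}"
      using assms length_le_sum_list by (auto simp: compositions_of_def Suc_le_eq)
  qed (auto simp: finite_compositions_of)
  also have "(\<lambda>k. {ps. ps \<in> compositions_of n \<and> length ps = k}) = compositions n"
    by (rule ext) (auto simp: compositions_of_def compositions_def Suc_le_eq intro!: gr0I)
  finally show ?thesis .
qed

text \<open>For \<open>n = 0\<close> the only composition is the empty one, so the constant term is that of \<open>c\<close>.\<close>

definition formal_comp :: "('b list \<Rightarrow> 'b) \<Rightarrow> ('b list \<Rightarrow> 'b) \<Rightarrow> 'b list \<Rightarrow> 'b::comm_monoid_add" where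
  "formal_comp c d hs = (\<Sum>ps\<in>compositions_of (length hs). c (map d (blocks ps hs)))"

lemma multilinear_formal_comp:
  assumes "\<And>n. multilinear n c" "\<And>n. multilinear n d"
  shows "multilinear n (formal_comp c d)"
proof -
  have "multilinear n (\<lambda>hs. \<Sum>ps\<in>compositions_of n. c (map d (blocks ps hs)))"
  proof (rule multilinear_sum)
    fix ps assume "ps \<in> compositions_of n"
    then show "multilinear n (\<lambda>hs. c (map d (blocks ps hs)))"
      using multilinear_blocks[of ps c d] assms by (simp add: compositions_of_def)
  qed
  then show ?thesis by (subst multilinear_cong) (auto simp: formal_comp_def)
qed

lemma norm_blocks_le:
  fixes d :: "'b::real_normed_vector list \<Rightarrow> 'b"
  assumes "\<And>hs. length hs \<in> set ps \<Longrightarrow> norm (d hs) \<le> g (length hs) * prod_list (map norm hs)"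
    and "length hs = sum_list ps" "\<And>p. p \<in> set ps \<Longrightarrow> 0 \<le> g p"
  shows "prod_list (map norm (map d (blocks ps hs))) \<le> prod_list (map g ps) * prod_list (map norm hs)"
  using assms
proof (induction ps arbitrary: hs)
  case (Cons p ps)
  have t: "length (take p hs) = p" using Cons.prems(2) by simp
  have "prod_list (map norm (map d (blocks (p # ps) hs)))
      = norm (d (take p hs)) * prod_list (map norm (map d (blocks ps (drop p hs))))"
    by simp
  also have "\<dots> \<le> (g p * prod_list (map norm (take p hs)))
      * (prod_list (map g ps) * prod_list (map norm (drop p hs)))"
  proof (rule mult_mono)
    show "norm (d (take p hs)) \<le> g p * prod_list (map norm (take p hs))"
      using Cons.prems(1)[of "take p hs"] t by simp
    show "prod_list (map norm (map d (blocks ps (drop p hs)))) \<le> prod_list (map g ps) * prod_list (map norm (drop p hs))"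
      using Cons.prems by (intro Cons.IH) auto
    show "0 \<le> g p * prod_list (map norm (take p hs))"
      using Cons.prems(3)[of p] prod_norm_nonneg[of "take p hs"] by simp
  qed (rule prod_norm_nonneg)
  also have "\<dots> = (g p * prod_list (map g ps))
      * (prod_list (map norm (take p hs)) * prod_list (map norm (drop p hs)))"
    by (simp only: mult_ac)
  finally show ?case by (simp only: prod_norm_take_drop) simp
qed simp

lemma prod_list_divide_const:
  fixes r :: real
  shows "prod_list (map (\<lambda>p. g p / r) ps) = prod_list (map g ps) / r ^ length ps"
  by (induction ps) auto

lemma norm_formal_comp_term_le:
  fixes c d :: "'b::complex_banach_algebra list \<Rightarrow> 'b"
  assumes c: "\<And>hs. norm (c hs) \<le> M / r ^ length hs * prod_list (map norm hs)" and "0 \<le> M" "0 < r"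
    and "\<And>hs. length hs \<in> set ps \<Longrightarrow> norm (d hs) \<le> g (length hs) * prod_list (map norm hs)"
    and "length hs = sum_list ps" "\<And>p. p \<in> set ps \<Longrightarrow> 0 \<le> g p"
  shows "norm (c (map d (blocks ps hs))) \<le> M * prod_list (map (\<lambda>p. g p / r) ps) * prod_list (map norm hs)"
proof -
  have "norm (c (map d (blocks ps hs))) \<le> M / r ^ length ps * prod_list (map norm (map d (blocks ps hs)))"
    using c[of "map d (blocks ps hs)"] by simp
  also have "\<dots> \<le> M / r ^ length ps * (prod_list (map g ps) * prod_list (map norm hs))"
    using assms(2,3) by (intro mult_left_mono[OF norm_blocks_le[OF assms(4-6)]]) auto
  also have "\<dots> = M * prod_list (map (\<lambda>p. g p / r) ps) * prod_list (map norm hs)"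
    by (simp add: prod_list_divide_const)
  finally show ?thesis .
qed

lemma map_blocks_replicate:
  "sum_list ps = n \<Longrightarrow> map d (blocks ps (replicate n h)) = map (\<lambda>p. d (replicate p h)) ps"
  by (induction ps arbitrary: n) (auto simp: min_absorb1)

lemma sum_geometric_from_1_le:
  fixes t :: real
  assumes "0 \<le> t" "t < 1"
  shows "(\<Sum>p=1..n. t ^ p) \<le> t / (1 - t)"
proof -
  have "(\<Sum>p=1..n. t ^ p) = (\<Sum>p<n. t * t ^ p)"
    by (rule sum.reindex_bij_witness[where i = Suc and j = "\<lambda>p. p - 1"])
      (auto simp: power_Suc[symmetric] simp del: power_Suc)
  also have "\<dots> \<le> (\<Sum>p. t * t ^ p)"
    using assms by (intro sum_le_suminf summable_mult summable_geometric) auto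
  also have "\<dots> = t / (1 - t)"
    using assms by (subst suminf_mult) (auto simp: suminf_geometric)
  finally show ?thesis .
qed

lemma prod_list_scaled_powers:
  fixes t s :: real
  shows "prod_list (map (\<lambda>p. A * (t / s) ^ p) ps)
    = prod_list (map (\<lambda>p. A * t ^ p) ps) / s ^ sum_list ps"
  by (induction ps) (auto simp: power_divide power_add)

text \<open>Put $u_p = d_p(h, \ldots, h)$, so that $y = \sum_{p \ge 1} u_p$ is the increment of $G$. All terms
  $c_k(u_{p_1}, \ldots, u_{p_k})$, indexed by the lists $(p_1, \ldots, p_k)$ of positive integers, are
  absolutely summable for small $h$: grouped by the length $k$ they give $\sum_k c_k(y, \ldots, y)$, which is
  the composite function, and grouped by $p_1 + \cdots + p_k$ they give the formal composition.\<close>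

lemma power_series_compose:
  assumes F: "power_series F (G a) c M r" and G: "power_series G a d N s"
  shows "\<exists>\<rho>. power_series (\<lambda>x. F (G x)) a (formal_comp c d) (2 * M) \<rho>"
proof -
  note r = power_series_radius_pos[OF F] and M = power_series_const_nonneg[OF F]
  note s = power_series_radius_pos[OF G] and N = power_series_const_nonneg[OF G]
  \<comment> \<open>\<open>t\<close> is chosen so that the increments of \<open>G\<close>, relative to the radius \<open>r\<close> of \<open>F\<close>, have total size
    $\sum_{p \ge 1} (N/r) t^p \le 1/2$.\<close>
  define t where "t = 1 / (2 + 2 * N / r)"
  define w where "w = (\<lambda>p. N / r * t ^ p)"
  have Nr: "0 \<le> N / r" using N r by simp
  have t: "0 < t" "t < 1" using Nr by (auto simp: t_def)
  have w0: "0 \<le> w p" for p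
    unfolding w_def using t by (intro mult_nonneg_nonneg Nr) simp
  have W: "(\<Sum>p=1..n. w p) \<le> 1 / 2" for n
  proof -
    have "(\<Sum>p=1..n. w p) \<le> N / r * (t / (1 - t))"
      unfolding w_def sum_distrib_left[symmetric] using t Nr
      by (intro mult_left_mono sum_geometric_from_1_le) auto
    also have "t / (1 - t) = 1 / (1 + 2 * (N / r))"
    proof -
      have "1 / (2 + 2 * q) / (1 - 1 / (2 + 2 * q)) = 1 / (1 + 2 * q)" if "0 \<le> q" for q :: real
        using that by (simp add: divide_simps)
      from this[OF Nr] show ?thesis by (simp add: t_def)
    qed
    also have "N / r * (1 / (1 + 2 * (N / r))) \<le> 1 / 2"
    proof -
      have "q * (1 / (1 + 2 * q)) \<le> 1 / 2" if "0 \<le> q" for q :: real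
        using that by (simp add: divide_simps)
      from this[OF Nr] show ?thesis .
    qed
    finally show ?thesis .
  qed
  have sum_le: "(\<Sum>ps\<in>X. prod_list (map w ps)) \<le> 2"
    if "finite X" "\<And>ps. ps \<in> X \<Longrightarrow> 0 \<notin> set ps" for X
    using sum_prod_list_le[of w "1 / 2" X 0, OF w0 W] that by simp
  have "power_series (\<lambda>x. F (G x)) a (formal_comp c d) (2 * M) (s * t)"
    unfolding power_series_def
  proof (intro conjI allI impI multilinear_formal_comp power_series_multilinear[OF F] power_series_multilinear[OF G])
    show "0 < s * t" using s t by simp
    fix hs :: "'a list"
    let ?n = "length hs"
    have "norm (formal_comp c d hs) \<le> (\<Sum>ps\<in>compositions_of ?n.
        M * (prod_list (map w ps) / (s * t) ^ ?n) * prod_list (map norm hs))"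
      unfolding formal_comp_def
    proof (rule sum_norm_le)
      fix ps assume ps: "ps \<in> compositions_of ?n"
      have "norm (c (map d (blocks ps hs)))
          \<le> M * prod_list (map (\<lambda>p. N / s ^ p / r) ps) * prod_list (map norm hs)"
        using ps N s power_series_norm_le[OF F] power_series_norm_le[OF G] r M
        by (intro norm_formal_comp_term_le) (auto simp: compositions_of_def)
      also have "(\<lambda>p. N / s ^ p / r) = (\<lambda>p. (N / r) * (t / (s * t)) ^ p)"
        using t s by (auto simp: power_divide)
      also have "prod_list (map (\<lambda>p. (N / r) * (t / (s * t)) ^ p) ps) = prod_list (map w ps) / (s * t) ^ ?n"
        unfolding prod_list_scaled_powers w_def using ps by (simp add: compositions_of_def)
      finally show "norm (c (map d (blocks ps hs)))
          \<le> M * (prod_list (map w ps) / (s * t) ^ ?n) * prod_list (map norm hs)" .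
    qed
    also have "\<dots> = (\<Sum>ps\<in>compositions_of ?n. prod_list (map w ps))
        * (M / (s * t) ^ ?n * prod_list (map norm hs))"
      unfolding sum_distrib_right by (simp add: mult_ac)
    also have "\<dots> \<le> 2 * (M / (s * t) ^ ?n * prod_list (map norm hs))"
      using M s t prod_norm_nonneg[of hs]
      by (intro mult_right_mono sum_le finite_compositions_of) (auto simp: compositions_of_def)
    finally show "norm (formal_comp c d hs) \<le> 2 * M / (s * t) ^ ?n * prod_list (map norm hs)" by simp
  next
    fix h :: 'a assume h: "norm h < s * t"
    define u where "u = (\<lambda>p. d (replicate p h))"
    define y where "y = G (a + h) - G a"
    have "s * t < s" using s t by simp
    then have hs: "norm h < s" using h by simp
    have q: "norm h / s \<le> t" using h s by (simp add: field_simps)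
    have u_le: "norm (u p) / r \<le> w p" for p
    proof -
      have "norm (u p) / r \<le> N * (norm h / s) ^ p / r"
        using power_series_term_norm_le[OF G, of p h] r by (simp add: u_def divide_right_mono)
      also have "\<dots> \<le> N * t ^ p / r"
        using q N r s by (intro divide_right_mono mult_left_mono power_mono) auto
      finally show ?thesis by (simp add: w_def)
    qed
    have u_W: "(\<Sum>p=1..n. norm (u p)) \<le> r / 2" for n
    proof -
      have "(\<Sum>p=1..n. norm (u p) / r) \<le> 1 / 2"
        by (rule order_trans[OF sum_mono W]) (rule u_le)
      then show ?thesis using r by (simp add: sum_divide_distrib[symmetric] field_simps)
    qed
    have "(u has_sum G (a + h)) UNIV"
      unfolding u_def
      by (rule norm_summable_imp_has_sum[OF power_series_norm_summable[OF G hs] power_series_sums[OF G hs]])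
    from has_sum_Diff[OF this has_sum_finite[of "{0}" u]]
    have "(u has_sum y) (UNIV - {0})"
      by (simp add: u_def y_def power_series_coeff_Nil[OF G])
    moreover have "UNIV - {0} = {1::nat..}" by auto
    ultimately have y: "(u has_sum y) {1..}" by simp
    have "norm y \<le> r / 2"
    proof -
      have "(\<lambda>n. \<Sum>p=1..n. u p) \<longlonglongrightarrow> y"
      proof -
        have "(\<lambda>n. \<Sum>p\<in>{..n} - {0}. u p) \<longlonglongrightarrow> y"
          using power_series_sums[OF G hs]
          by (auto simp: sums_def_le sum_diff1 y_def u_def power_series_coeff_Nil[OF G] intro!: tendsto_diff)
        moreover have "{..n} - {0} = {1..n}" for n :: nat by auto
        ultimately show ?thesis by simp
      qed
      then show ?thesis
        by (rule Lim_bounded[OF tendsto_norm, of _ _ 0])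
          (use order_trans[OF norm_sum u_W] in auto)
    qed
    then have yr: "norm y < r" using r by simp
    define f where "f = (\<lambda>ps. c (map u ps))"
    have "f abs_summable_on {ps. 0 \<notin> set ps}"
      unfolding abs_summable_iff_bdd_above
    proof (rule bdd_aboveI2)
      fix X :: "nat list set" assume "X \<in> {X. X \<subseteq> {ps. 0 \<notin> set ps} \<and> finite X}"
      then have X: "finite X" "\<And>ps. ps \<in> X \<Longrightarrow> 0 \<notin> set ps" by auto
      have "(\<Sum>ps\<in>X. norm (f ps)) \<le> (\<Sum>ps\<in>X. M * prod_list (map w ps))"
      proof (rule sum_mono)
        fix ps
        have "norm (f ps) \<le> M / r ^ length ps * prod_list (map (\<lambda>p. norm (u p)) ps)"
          using power_series_norm_le[OF F, of "map u ps"] by (simp add: f_def o_def)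
        also have "\<dots> = M * prod_list (map (\<lambda>p. norm (u p) / r) ps)"
          by (simp add: prod_list_divide_const)
        also have "prod_list (map (\<lambda>p. norm (u p) / r) ps) \<le> prod_list (map w ps)"
        proof (induction ps)
          case (Cons p ps)
          have "0 \<le> prod_list (map (\<lambda>p. norm (u p) / r) ps)"
            using r by (intro prod_list_nonneg_real) auto
          from mult_mono[OF u_le[of p] Cons.IH w0[of p] this] show ?case by simp
        qed simp
        finally show "norm (f ps) \<le> M * prod_list (map w ps)" using M by (simp add: mult_left_mono)
      qed
      also have "\<dots> \<le> M * 2"
        unfolding sum_distrib_left[symmetric] by (intro mult_left_mono sum_le X M)
      finally show "(\<Sum>ps\<in>X. norm (f ps)) \<le> M * 2" .
    qed
    then obtain S where S: "(f has_sum S) {ps. 0 \<notin> set ps}"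
      using abs_summable_summable summable_on_def by blast
    have "(\<lambda>k. c (replicate k y)) sums S"
    proof (rule has_sum_fibres_imp_sums[OF S])
      fix k
      have "(f has_sum c (replicate k y)) {ps. length ps = k \<and> 0 \<notin> set ps}"
        unfolding f_def
        by (rule multilinear_lists_has_sum[OF power_series_multilinear[OF F] _ _ u_W y, where K = "M / r ^ k"])
          (use power_series_norm_le[OF F] M r in auto)
      moreover have "{ps \<in> {ps. 0 \<notin> set ps}. length ps = k} = {ps. length ps = k \<and> (0::nat) \<notin> set ps}"
        by auto
      ultimately show "(f has_sum c (replicate k y)) {ps \<in> {ps. 0 \<notin> set ps}. length ps = k}"
        by simp
    qed
    moreover have "(\<lambda>k. c (replicate k y)) sums F (G a + y)"
      by (rule power_series_sums[OF F yr])
    ultimately have "S = F (G (a + h))" using sums_unique2 by (fastforce simp: y_def)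
    moreover have "(\<lambda>n. formal_comp c d (replicate n h)) sums S"
    proof (rule has_sum_fibres_imp_sums[OF S])
      fix n
      have eq: "{ps \<in> {ps. 0 \<notin> set ps}. sum_list ps = n} = compositions_of n"
        by (auto simp: compositions_of_def)
      have "formal_comp c d (replicate n h) = (\<Sum>ps\<in>compositions_of n. f ps)"
        unfolding formal_comp_def f_def u_def
        by (intro sum.cong) (auto simp: map_blocks_replicate compositions_of_def)
      then show "(f has_sum formal_comp c d (replicate n h)) {ps \<in> {ps. 0 \<notin> set ps}. sum_list ps = n}"
        unfolding eq by (intro has_sum_finiteI finite_compositions_of)
    qed
    ultimately show "(\<lambda>n. formal_comp c d (replicate n h)) sums F (G (a + h))" by simp
  qed
  then show ?thesis by blast
qed

section \<open>The multilinear function series of sums, products and composites\<close>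

lemma of_B_add: "of_B a + of_B b = of_B (a + b)"
  and of_B_mult: "of_B a \<otimes>\<^sub>B of_B b = of_B (a * b)"
  and of_B_sum: "of_B (sum g I) = (\<Sum>i\<in>I. of_B (g i))"
  and fst_of_B [simp]: "fst (of_B a) = a"
  and of_B_inject [simp]: "of_B a = of_B b \<longleftrightarrow> a = b"
  and of_B_0: "of_B 0 = 0"
  by (auto simp: of_B_def Btilde_mult_def prod_eq_iff fst_sum snd_sum zero_prod_def)

text \<open>On series with terms in the algebra itself the operations on \<open>Btilde\<close>-valued series reduce to
  the formal operations on coefficients.\<close>

lemma series_mult_of_B:
  "(\<lambda>bs. of_B (c bs)) *\<^sub>f (\<lambda>bs. of_B (d bs)) = (\<lambda>bs. of_B (formal_mult c d bs))"
  by (rule ext) (simp add: series_mult_def formal_mult_def of_B_mult of_B_sum atLeast0AtMost)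

lemma series_comp_of_B:
  "(\<lambda>bs. of_B (c bs)) \<circ>\<^sub>f (\<lambda>bs. of_B (d bs)) = (\<lambda>bs. of_B (formal_comp c d bs))"
proof (rule ext)
  fix bs :: "'a list"
  show "((\<lambda>bs. of_B (c bs)) \<circ>\<^sub>f (\<lambda>bs. of_B (d bs))) bs = of_B (formal_comp c d bs)"
  proof (cases "bs = []")
    case True
    then show ?thesis by (simp add: series_comp_def formal_comp_def)
  next
    case False
    have "map (\<lambda>j. fst (of_B (d (block ps bs j)))) [0..<k] = map d (blocks ps bs)"
      if "ps \<in> compositions (length bs) k" for ps k
      using map_block_eq_blocks[of d ps bs] that by (simp add: compositions_def)
    then show ?thesis
      using False by (simp add: series_comp_def formal_comp_def sum_compositions_of of_B_sum)
  qed
qed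

lemma sym_mult_of_B:
  "(\<lambda>bs. of_B (c bs)) \<cdot>\<^sub>s (\<lambda>bs. of_B (d bs)) = (\<lambda>bs. of_B (symmetrize (formal_mult c d) bs))"
  unfolding sym_mult_def series_mult_of_B Sym_of_B ..

lemma sym_comp_of_B:
  "(\<lambda>bs. of_B (c bs)) \<circ>\<^sub>s (\<lambda>bs. of_B (d bs)) = (\<lambda>bs. of_B (symmetrize (formal_comp c d) bs))"
  unfolding sym_comp_def series_comp_of_B Sym_of_B ..

lemma analytic_near_0_expansion:
  assumes "analytic_near_0 F"
  obtains c M r where "power_series F 0 c M r" "\<And>n. symmetric_fn n c" "mfs F = (\<lambda>hs. of_B (c hs))"
proof -
  obtain c M r where c: "power_series F 0 c M r" "\<And>n. symmetric_fn n c"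
    using assms unfolding analytic_near_0_def banach_analytic_at_iff by blast
  have "symmetrize c hs = c hs" for hs by (rule symmetrize_symmetric[OF c(2)])
  then show ?thesis using that c mfs_power_series[OF c(1)] by simp
qed

lemma mfs_add:
  assumes "analytic_near_0 F" "analytic_near_0 G"
  shows "analytic_near_0 (\<lambda>b. F b + G b)" "mfs (\<lambda>b. F b + G b) = mfs F +\<^sub>f mfs G"
proof -
  obtain c M r where c: "power_series F 0 c M r" "\<And>n. symmetric_fn n c" "mfs F = (\<lambda>hs. of_B (c hs))"
    using analytic_near_0_expansion[OF assms(1)] by blast
  obtain d N s where d: "power_series G 0 d N s" "\<And>n. symmetric_fn n d" "mfs G = (\<lambda>hs. of_B (d hs))"
    using analytic_near_0_expansion[OF assms(2)] by blast
  note ps = power_series_add[OF c(1) d(1)]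
  show "analytic_near_0 (\<lambda>b. F b + G b)" by (rule power_series_imp_analytic_near_0[OF ps])
  show "mfs (\<lambda>b. F b + G b) = mfs F +\<^sub>f mfs G"
    unfolding mfs_power_series[OF ps] c(3) d(3)
    using c(2) d(2) by (simp add: series_add_def of_B_add symmetrize_add symmetrize_symmetric)
qed

lemma mfs_mult:
  assumes "analytic_near_0 F" "analytic_near_0 G"
  shows "analytic_near_0 (\<lambda>b. F b * G b)" "mfs (\<lambda>b. F b * G b) = mfs F \<cdot>\<^sub>s mfs G"
proof -
  obtain c M r where c: "power_series F 0 c M r" "\<And>n. symmetric_fn n c" "mfs F = (\<lambda>hs. of_B (c hs))"
    using analytic_near_0_expansion[OF assms(1)] by blast
  obtain d N s where d: "power_series G 0 d N s" "\<And>n. symmetric_fn n d" "mfs G = (\<lambda>hs. of_B (d hs))"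
    using analytic_near_0_expansion[OF assms(2)] by blast
  note ps = power_series_mult[OF c(1) d(1)]
  show "analytic_near_0 (\<lambda>b. F b * G b)" by (rule power_series_imp_analytic_near_0[OF ps])
  show "mfs (\<lambda>b. F b * G b) = mfs F \<cdot>\<^sub>s mfs G"
    unfolding mfs_power_series[OF ps] c(3) d(3) sym_mult_of_B ..
qed

lemma mfs_compose:
  assumes "analytic_near_0 F" "analytic_near_0 G" "G 0 = 0"
  shows "analytic_near_0 (\<lambda>b. F (G b))" "mfs (\<lambda>b. F (G b)) = mfs F \<circ>\<^sub>s mfs G"
proof -
  obtain c M r where c: "power_series F 0 c M r" "\<And>n. symmetric_fn n c" "mfs F = (\<lambda>hs. of_B (c hs))"
    using analytic_near_0_expansion[OF assms(1)] by blast
  obtain d N s where d: "power_series G 0 d N s" "\<And>n. symmetric_fn n d" "mfs G = (\<lambda>hs. of_B (d hs))"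
    using analytic_near_0_expansion[OF assms(2)] by blast
  have "power_series F (G 0) c M r" using c(1) assms(3) by simp
  from power_series_compose[OF this d(1)]
  obtain \<rho> where ps: "power_series (\<lambda>x. F (G x)) 0 (formal_comp c d) (2 * M) \<rho>" by blast
  show "analytic_near_0 (\<lambda>b. F (G b))" by (rule power_series_imp_analytic_near_0[OF ps])
  show "mfs (\<lambda>b. F (G b)) = mfs F \<circ>\<^sub>s mfs G"
    unfolding mfs_power_series[OF ps] c(3) d(3) sym_comp_of_B ..
qed

section \<open>Inverses under multiplication\<close>

lemma power_series_of_coefficients:
  fixes c :: "'b::complex_banach_algebra list \<Rightarrow> 'b"
  assumes "\<And>n. multilinear n c" and r: "0 < r"
    and c: "\<And>hs. norm (c hs) \<le> M / r ^ length hs * prod_list (map norm hs)"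
  shows "power_series (\<lambda>h. \<Sum>n. c (replicate n h)) 0 c M r"
  unfolding power_series_def
proof (intro conjI allI impI assms)
  fix h :: 'b assume h: "norm h < r"
  have "summable (\<lambda>n. c (replicate n h))"
  proof (rule summable_comparison_test)
    have "norm (c (replicate n h)) \<le> M * (norm h / r) ^ n" for n
      using c[of "replicate n h"] by (simp add: power_divide)
    then show "\<exists>N. \<forall>n\<ge>N. norm (c (replicate n h)) \<le> M * (norm h / r) ^ n" by blast
    show "summable (\<lambda>n. M * (norm h / r) ^ n)"
      using h r by (intro summable_mult summable_geometric) auto
  qed
  then show "(\<lambda>n. c (replicate n h)) sums (\<Sum>n. c (replicate n (0 + h)))"
    by (simp add: summable_sums)
qed

lemma power_series_eventually_eqI:
  assumes "power_series F 0 c M r" "\<And>h. (\<lambda>n. c (replicate n h)) sums L h"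
  shows "\<forall>\<^sub>F h in nhds 0. F h = L h"
proof -
  have "F h = L h" if "norm h < r" for h
    using sums_unique2[OF power_series_sums[OF assms(1) that] assms(2)] by simp
  then show ?thesis
    unfolding eventually_nhds_metric using power_series_radius_pos[OF assms(1)] by auto
qed

text \<open>Only the constant term of a series can leave the algebra.\<close>

lemma SymMul_of_B:
  assumes "\<beta> \<in> SymMul" "\<beta> [] = of_B u"
  obtains b where "\<beta> = (\<lambda>hs. of_B (b hs))" "\<And>n. multilinear n b" "\<And>n. symmetric_fn n b"
proof -
  obtain \<alpha> where \<alpha>: "\<alpha> \<in> Mul" "\<beta> = Sym \<alpha>" using assms(1) by (auto simp: SymMul_def)
  define a where "a = (\<lambda>hs. fst (\<alpha> hs))"
  have "\<alpha> [] = of_B u"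
    using assms(2) unfolding \<alpha>(2) by (simp add: Sym_def lessThan_0)
  then have "\<alpha> hs = of_B (a hs)" for hs
  proof (cases "hs = []")
    case True
    with \<open>\<alpha> [] = of_B u\<close> show ?thesis by (simp add: a_def)
  next
    case False
    then have "1 \<le> length hs" by (cases hs) auto
    then have "\<alpha> hs \<in> range of_B" using \<alpha>(1) unfolding Mul_def by blast
    then show ?thesis by (auto simp: a_def)
  qed
  then have "\<alpha> = (\<lambda>hs. of_B (a hs))" by (rule ext)
  then have \<beta>: "\<beta> = (\<lambda>hs. of_B (symmetrize a hs))" unfolding \<alpha>(2) by (simp add: Sym_of_B)
  have "multilinear n a" for n
  proof (cases n)
    case 0
    then show ?thesis by (simp add: multilinear_def)
  next
    case (Suc m)
    then show ?thesis using \<alpha>(1) by (simp add: a_def Mul_def)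
  qed
  then show ?thesis
    by (intro that[OF \<beta>] multilinear_symmetrize symmetric_symmetrize)
qed

lemma linear_mult_left: "linear (\<lambda>x::'a::real_algebra. u * x)"
  by (rule linearI) (auto simp: distrib_left)

text \<open>The equation $(c b)_n = 0$ reads $c_0 b_n = - \mathrm{Sym} \sum_{k=1}^n c_k\, b_{n-k}$. Multiplying by the inverse $u$
  of $c_0$ gives $\|b_n\| \le \|u\| \sum_{k=1}^n M r^{-k} \|b_{n-k}\|$, and induction yields $\|b_n\| \le D (r q)^{-n}$
  provided that $\|u\| M \sum_{k \ge 1} q^k \le 1$.\<close>

lemma formal_mult_inverse_bound:
  fixes b c :: "'b::complex_banach_algebra list \<Rightarrow> 'b"
  assumes c: "\<And>hs. norm (c hs) \<le> M / r ^ length hs * prod_list (map norm hs)" and r: "0 < r"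
    and sym: "\<And>n. symmetric_fn n b"
    and inv: "\<And>hs. hs \<noteq> [] \<Longrightarrow> symmetrize (formal_mult c b) hs = 0"
    and u: "\<And>x. u * (c [] * x) = x"
  shows "\<exists>D \<rho>. 0 < \<rho> \<and> (\<forall>hs. norm (b hs) \<le> D / \<rho> ^ length hs * prod_list (map norm hs))"
proof -
  have M: "0 \<le> M" using order_trans[OF norm_ge_zero c[of "[]"]] by simp
  define D q where "D = norm (b [])" and "q = 1 / (2 + norm u * M)"
  have uM: "0 \<le> norm u * M" using M by simp
  have q: "0 < q" "q < 1" using uM by (auto simp: q_def add_pos_nonneg divide_simps)
  have qq: "norm u * M * (q / (1 - q)) \<le> 1"
  proof -
    have "x * (1 / (2 + x) / (1 - 1 / (2 + x))) \<le> 1" if "0 \<le> x" for x :: real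
      using that by (simp add: divide_simps)
    from this[OF uM] show ?thesis by (simp add: q_def)
  qed
  define \<rho> where "\<rho> = r * q"
  have \<rho>: "0 < \<rho>" using r q by (simp add: \<rho>_def)
  have D: "0 \<le> D" by (simp add: D_def)
  have "norm (b hs) \<le> D / \<rho> ^ length hs * prod_list (map norm hs)" for hs
  proof (induction "length hs" arbitrary: hs rule: less_induct)
    case less
    show ?case
    proof (cases "hs = []")
      case True
      then show ?thesis by (simp add: D_def)
    next
      case False
      define n where "n = length hs"
      define T where "T = (\<lambda>hs. \<Sum>k=1..length hs. c (take k hs) * b (drop k hs))"
      have split: "formal_mult c b gs = c [] * b gs + T gs" for gs
      proof -
        have "{..length gs} = insert 0 {1..length gs}" by auto
        then show ?thesis by (simp add: formal_mult_def T_def)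
      qed
      have "0 = symmetrize (formal_mult c b) hs" using inv[OF False] by simp
      also have "\<dots> = symmetrize (\<lambda>gs. c [] * b gs) hs + symmetrize T hs"
        unfolding split by (rule symmetrize_add)
      also have "symmetrize (\<lambda>gs. c [] * b gs) hs = c [] * b hs"
        unfolding linear_mult_left[THEN symmetrize_linear, symmetric] by (simp add: symmetrize_symmetric[OF sym])
      finally have "c [] * b hs = - symmetrize T hs" by (simp add: eq_neg_iff_add_eq_0)
      then have b: "b hs = - (u * symmetrize T hs)" using u[of "b hs"] by simp
      have "norm (symmetrize T hs) \<le> (M * D / \<rho> ^ n * (q / (1 - q))) * prod_list (map norm hs)"
      proof (rule symmetrize_norm_le)
        fix cs :: "'b list" assume len: "length cs = length hs"
        have "norm (T cs) \<le> (\<Sum>k=1..n. M * D / \<rho> ^ n * prod_list (map norm cs) * q ^ k)"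
          unfolding T_def len n_def[symmetric]
        proof (rule sum_norm_le)
          fix k assume k: "k \<in> {1..n}"
          have "norm (c (take k cs) * b (drop k cs)) \<le> (M / r ^ k) * (D / \<rho> ^ (n - k)) * prod_list (map norm cs)"
            using c[of "take k cs"] less[of "drop k cs"] k len
            by (intro norm_mult_split_le) (auto simp: n_def min_absorb2)
          also have "(M / r ^ k) * (D / \<rho> ^ (n - k)) = M * D / \<rho> ^ n * q ^ k"
          proof -
            have "\<rho> ^ n = \<rho> ^ (n - k) * (r ^ k * q ^ k)"
              using k by (simp add: \<rho>_def power_mult_distrib[symmetric] power_add[symmetric])
            then show ?thesis using q r by simp
          qed
          finally show "norm (c (take k cs) * b (drop k cs))
              \<le> M * D / \<rho> ^ n * prod_list (map norm cs) * q ^ k"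
            by (simp only: mult_ac)
        qed
        also have "\<dots> \<le> M * D / \<rho> ^ n * prod_list (map norm cs) * (q / (1 - q))"
          unfolding sum_distrib_left[symmetric] using M D \<rho> q prod_norm_nonneg[of cs]
          by (intro mult_left_mono sum_geometric_from_1_le) auto
        finally show "norm (T cs) \<le> (M * D / \<rho> ^ n * (q / (1 - q))) * prod_list (map norm cs)"
          by (simp only: mult_ac)
      qed
      then have "norm (b hs) \<le> norm u * ((M * D / \<rho> ^ n * (q / (1 - q))) * prod_list (map norm hs))"
        unfolding b norm_minus_cancel
        by (rule order_trans[OF norm_mult_ineq mult_left_mono]) simp
      also have "\<dots> = (norm u * M * (q / (1 - q))) * (D / \<rho> ^ n * prod_list (map norm hs))"
        by (simp add: mult_ac)
      also have "\<dots> \<le> 1 * (D / \<rho> ^ n * prod_list (map norm hs))"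
        using D \<rho> prod_norm_nonneg[of hs] by (intro mult_right_mono qq) auto
      finally show ?thesis by (simp add: n_def)
    qed
  qed
  then show ?thesis using \<rho> by blast
qed

text \<open>Existence of a formal inverse already forces the algebra to have an identity, as seen from the
  constant terms; after that all series take values in the algebra.\<close>

lemma germ_mult_invertible_if_sym_mult_invertible:
  fixes F :: "'b::complex_banach_algebra \<Rightarrow> 'b"
  assumes F: "analytic_near_0 F" and inv: "sym_mult_invertible (mfs F)"
  shows "germ_mult_invertible F"
proof -
  obtain c M r where c: "power_series F 0 c M r" "\<And>n. symmetric_fn n c" "mfs F = (\<lambda>hs. of_B (c hs))"
    using analytic_near_0_expansion[OF F] by blast
  obtain \<beta> where \<beta>: "\<beta> \<in> SymMul" "mfs F \<cdot>\<^sub>s \<beta> = series_one" "\<beta> \<cdot>\<^sub>s mfs F = series_one"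
    using inv unfolding sym_mult_invertible_def by blast
  have Sym_Nil: "Sym \<alpha> [] = \<alpha> []" for \<alpha> :: "'b series"
    by (simp add: Sym_def lessThan_0)
  have "of_B (c []) \<otimes>\<^sub>B \<beta> [] = Btilde_one"
    using fun_cong[OF \<beta>(2), of "[]"] by (simp add: sym_mult_def Sym_Nil series_mult_def series_one_def c(3))
  \<comment> \<open>In a non-unital algebra the constant term of the product has scalar part 0, that of the
    identity has scalar part 1.\<close>
  then have unital: "\<exists>e::'b. is_identity e"
    by (auto simp: Btilde_mult_def of_B_def Btilde_one_def split: if_splits)
  define e where "e = (THE e::'b. is_identity e)"
  have "is_identity e"
    unfolding e_def
    by (rule theI') (use unital in \<open>auto simp: is_identity_def, metis\<close>)
  then have e: "e * x = x" "x * e = x" for x by (auto simp: is_identity_def)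
  have one: "Btilde_one = of_B e" using unital by (simp add: Btilde_one_def e_def of_B_def)
  obtain \<alpha> where \<alpha>: "\<alpha> \<in> Mul" "\<beta> = Sym \<alpha>" using \<beta>(1) by (auto simp: SymMul_def)
  then have "snd (\<beta> []) = 0" using unital by (auto simp: Mul_def Btilde_def Sym_Nil)
  then have "\<beta> [] = of_B (fst (\<beta> []))" by (simp add: of_B_def prod_eq_iff)
  then obtain b where b: "\<beta> = (\<lambda>hs. of_B (b hs))" "\<And>n. multilinear n b" "\<And>n. symmetric_fn n b"
    using SymMul_of_B[OF \<beta>(1)] by blast
  have cb: "symmetrize (formal_mult c b) hs = (if hs = [] then e else 0)"
    and bc: "symmetrize (formal_mult b c) hs = (if hs = [] then e else 0)" for hs
  proof -
    have "of_B (symmetrize (formal_mult c b) hs) = series_one hs"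
      "of_B (symmetrize (formal_mult b c) hs) = series_one hs"
      using fun_cong[OF \<beta>(2), of hs] fun_cong[OF \<beta>(3), of hs] unfolding c(3) b(1) sym_mult_of_B by auto
    then show "symmetrize (formal_mult c b) hs = (if hs = [] then e else 0)"
      "symmetrize (formal_mult b c) hs = (if hs = [] then e else 0)"
      unfolding series_one_def one of_B_0[symmetric] by (auto split: if_splits)
  qed
  have "b [] * (c [] * x) = x" for x
    using bc[of "[]"] by (simp add: formal_mult_def e mult.assoc[symmetric])
  then obtain D \<rho> where "0 < \<rho>" "\<And>hs. norm (b hs) \<le> D / \<rho> ^ length hs * prod_list (map norm hs)"
    using formal_mult_inverse_bound[of c M r b "b []"] power_series_norm_le[OF c(1)]
      power_series_radius_pos[OF c(1)] b(3) cb by auto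
  from power_series_of_coefficients[OF b(2) this]
  obtain H where H: "power_series H 0 b D \<rho>" by blast
  have e_sums: "(\<lambda>n. if replicate n h = [] then e else 0) sums e" for h :: 'b
    using sums_single[of 0 "\<lambda>_. e"] by (simp cong: if_cong)
  have "\<forall>\<^sub>F h in nhds 0. F h * H h = e"
    using power_series_eventually_eqI[OF power_series_symmetrize[OF power_series_mult[OF c(1) H]], of "\<lambda>_. e"]
      e_sums unfolding cb by blast
  moreover have "\<forall>\<^sub>F h in nhds 0. H h * F h = e"
    using power_series_eventually_eqI[OF power_series_symmetrize[OF power_series_mult[OF H c(1)]], of "\<lambda>_. e"]
      e_sums unfolding bc by blast
  ultimately have "\<forall>\<^sub>F h in nhds 0. of_B (F h * H h) = Btilde_one \<and> of_B (H h * F h) = Btilde_one"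
    by eventually_elim (simp add: one)
  then show ?thesis
    unfolding germ_mult_invertible_def using power_series_imp_analytic_near_0[OF H] by blast
qed

section \<open>Inverses under composition\<close>

text \<open>The bounded inverse theorem. By Baire's theorem some set \<open>{x. norm (g x) \<le> n}\<close> is dense in a ball, so every
  \<open>x\<close> is approximated up to half of its norm by some \<open>y\<close> with \<open>norm (g y) \<le> C * norm x\<close>. Applying this
  again to the remainders, the corrections form a geometric series, and \<open>x\<close> is a sum of vectors whose
  images under \<open>g\<close> are summable; continuity of \<open>f\<close> identifies their sum as \<open>g x\<close>.\<close>

lemma linear_inverse_bounded:
  fixes f :: "'a::banach \<Rightarrow> 'b::banach" and g :: "'b \<Rightarrow> 'a"
  assumes f: "bounded_linear f" and g: "linear g" and fg: "\<And>x. f (g x) = x" and gf: "\<And>x. g (f x) = x"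
  shows "\<exists>K. \<forall>x. norm (g x) \<le> K * norm x"
proof -
  define A where "A = (\<lambda>n::nat. {x. norm (g x) \<le> real n})"
  have "\<exists>n. interior (closure (A n)) \<noteq> {}"
  proof (rule ccontr)
    assume "\<nexists>n. interior (closure (A n)) \<noteq> {}"
    then have "euclidean interior_of \<Union> (range (\<lambda>n. closure (A n))) = {}"
      by (intro Baire_category_alt) (auto simp: completely_metrizable_space_euclidean simp flip: closed_closedin)
    moreover have "x \<in> (\<Union>n. closure (A n))" for x
    proof -
      obtain n where "norm (g x) \<le> real n" using real_arch_simple by blast
      then have "x \<in> A n" by (simp add: A_def)
      then show ?thesis using closure_subset by blast
    qed
    then have "(\<Union>n. closure (A n)) = UNIV" by blast
    ultimately show False by simp
  qed
  then obtain n x0 where "x0 \<in> interior (closure (A n))" by blast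
  then obtain \<epsilon> where \<epsilon>: "0 < \<epsilon>" "ball x0 \<epsilon> \<subseteq> closure (A n)" by (auto simp: mem_interior)
  define C where "C = 4 * real n / \<epsilon>"
  have C: "0 \<le> C" using \<epsilon> by (simp add: C_def)
  have "\<exists>y. norm (x - y) \<le> norm x / 2 \<and> norm (g y) \<le> C * norm x" for x
  proof (cases "x = 0")
    case True
    then show ?thesis using linear_0[OF g] by (intro exI[of _ 0]) simp
  next
    case False
    \<comment> \<open>Scale \<open>x\<close> into the ball and write it as a difference of two points of the ball; this removes
      the unknown centre \<open>x0\<close>.\<close>
    define l where "l = \<epsilon> / (2 * norm x)"
    have l: "0 < l" using False \<epsilon> by (simp add: l_def)
    have nl: "norm (l *\<^sub>R x) = \<epsilon> / 2" using False \<epsilon> by (simp add: l_def)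
    have "x0 + l *\<^sub>R x \<in> closure (A n)" "x0 \<in> closure (A n)"
      using \<epsilon> nl by (auto intro!: subsetD[OF \<epsilon>(2)] simp: dist_norm)
    then obtain p q where p: "p \<in> A n" "dist p (x0 + l *\<^sub>R x) < \<epsilon> / 8" and q: "q \<in> A n" "dist q x0 < \<epsilon> / 8"
      using \<epsilon>(1) unfolding closure_approachable by (meson divide_pos_pos zero_less_numeral)
    define y where "y = (1 / l) *\<^sub>R (p - q)"
    have "norm (l *\<^sub>R x - (p - q)) \<le> norm (q - x0) + norm (p - (x0 + l *\<^sub>R x))"
      using norm_triangle_ineq4[of "q - x0" "p - (x0 + l *\<^sub>R x)"] by (simp add: algebra_simps)
    also have "\<dots> \<le> \<epsilon> / 4" using p(2) q(2) by (simp add: dist_norm)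
    finally have 1: "norm (l *\<^sub>R x - (p - q)) \<le> \<epsilon> / 4" .
    have "x - y = (1 / l) *\<^sub>R (l *\<^sub>R x - (p - q))" using l by (simp add: y_def scaleR_diff_right)
    then have "norm (x - y) = norm (l *\<^sub>R x - (p - q)) / l" using l by simp
    also have "\<dots> \<le> \<epsilon> / 4 / l" using 1 l by (intro divide_right_mono) auto
    also have "\<dots> = norm x / 2" using \<epsilon> False by (simp add: l_def field_simps)
    finally have 2: "norm (x - y) \<le> norm x / 2" .
    have "norm (g p - g q) \<le> 2 * real n"
      using norm_triangle_ineq4[of "g p" "g q"] p(1) q(1) by (simp add: A_def)
    moreover have "g y = (1 / l) *\<^sub>R (g p - g q)" by (simp add: y_def linear_scale[OF g] linear_diff[OF g])
    ultimately have "norm (g y) \<le> 2 * real n / l" using l by (simp add: divide_right_mono)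
    also have "\<dots> = C * norm x" using \<epsilon> False by (simp add: l_def C_def field_simps)
    finally show ?thesis using 2 by blast
  qed
  then obtain Y where Y: "\<And>x. norm (x - Y x) \<le> norm x / 2" "\<And>x. norm (g (Y x)) \<le> C * norm x" by metis
  have "norm (g x) \<le> 2 * C * norm x" for x
  proof -
    define R where "R = (\<lambda>k. ((\<lambda>z. z - Y z) ^^ k) x)"
    have R_Suc: "R (Suc k) = R k - Y (R k)" for k by (simp add: R_def)
    have R: "norm (R k) \<le> norm x * (1 / 2) ^ k" for k
    proof (induction k)
      case 0
      then show ?case by (simp add: R_def)
    next
      case (Suc k)
      then show ?case using Y(1)[of "R k"] unfolding R_Suc by simp
    qed
    have gY: "norm (g (Y (R k))) \<le> C * norm x * (1 / 2) ^ k" for k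
      using order_trans[OF Y(2) mult_left_mono[OF R C], of k] by (simp add: mult_ac)
    have gs: "summable (\<lambda>k. C * norm x * (1 / 2) ^ k)" by (intro summable_mult summable_geometric) auto
    have sg: "summable (\<lambda>k. g (Y (R k)))"
      by (rule summable_comparison_test[OF _ gs]) (use gY in blast)
    define z where "z = (\<Sum>k. g (Y (R k)))"
    have "norm z \<le> (\<Sum>k. C * norm x * (1 / 2) ^ k)"
      unfolding z_def by (rule norm_suminf_le[OF gY gs])
    also have "\<dots> = 2 * C * norm x"
      by (subst suminf_mult) (auto simp: suminf_geometric)
    finally have nz: "norm z \<le> 2 * C * norm x" .
    have "(\<lambda>k. f (g (Y (R k)))) sums f z"
      unfolding z_def by (rule bounded_linear.sums[OF f summable_sums[OF sg]])
    then have "(\<lambda>k. R k - R (Suc k)) sums f z" by (simp add: fg R_Suc)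
    moreover have "R \<longlonglongrightarrow> 0"
    proof (rule Lim_null_comparison)
      show "\<forall>\<^sub>F k in sequentially. norm (R k) \<le> norm x * (1 / 2) ^ k" using R by simp
      show "(\<lambda>k. norm x * (1 / 2) ^ k) \<longlonglongrightarrow> 0"
        by (intro tendsto_mult_right_zero LIMSEQ_power_zero) simp
    qed
    from telescope_sums'[OF this] have "(\<lambda>k. R k - R (Suc k)) sums x" by (simp add: R_def)
    ultimately have "f z = x" by (rule sums_unique2)
    then have "g x = z" using gf by metis
    then show ?thesis using nz by simp
  qed
  then show ?thesis by blast
qed

text \<open>In degree $n \ge 2$ the equation $(c \circ b)_n = 0$ reads
  $c_1(b_n) = - \mathrm{Sym} \sum c_k(b_{p_1}, \ldots, b_{p_k})$, the sum being over compositions of $n$ with at least two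
  parts, all of which are smaller than $n$. Applying the bounded inverse of $c_1$ turns bounds $a_p$ for
  the earlier $b_p$ into a bound for $b_n$. Geometric growth is proved for the bounds collectively, in
  the style of Cauchy's majorants: if $\sum_p a_p t^p \le s$ up to some degree, then one degree further
  the sum is at most $K t + K M (s/r)^2 / (1 - s/r)$, because every new term has at least two
  factors. For $s$ small this is at most $s$ again, so the bound is uniform in the degree, and
  $a_n \le s t^{-n}$.\<close>

lemma formal_comp_inverse_bound:
  fixes b c :: "'b::complex_banach_algebra list \<Rightarrow> 'b"
  assumes c: "\<And>hs. norm (c hs) \<le> M / r ^ length hs * prod_list (map norm hs)" and r: "0 < r"
    and cm: "multilinear 1 c" and sym: "\<And>n. symmetric_fn n b" and b0: "b [] = 0"
    and inv: "\<And>hs. 2 \<le> length hs \<Longrightarrow> symmetrize (formal_comp c b) hs = 0"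
    and bc: "\<And>x. b [c [x]] = x" and bK: "\<And>x. norm (b [x]) \<le> K * norm x"
  shows "\<exists>D \<rho>. 0 < \<rho> \<and> (\<forall>hs. norm (b hs) \<le> D / \<rho> ^ length hs * prod_list (map norm hs))"
proof -
  have M: "0 \<le> M" using order_trans[OF norm_ge_zero c[of "[]"]] by simp
  define K' where "K' = max K 1"
  have K': "0 < K'" and bK': "norm (b [x]) \<le> K' * norm x" for x
    using order_trans[OF bK mult_right_mono[of K K' "norm x"]] by (auto simp: K'_def)
  \<comment> \<open>With these values each of the two summands in \<open>budget\<close> is at most \<open>s / 2\<close>.\<close>
  define s where "s = min (r / 2) (r\<^sup>2 / (4 * K' * M + 1))"
  define t where "t = s / (2 * K')"
  have p: "0 < 4 * K' * M + 1" using K' M by (simp add: add_nonneg_pos)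
  have s: "0 < s" "s \<le> r / 2"
    unfolding s_def using r p by (simp_all only: min_less_iff_conj min.cobounded1) simp_all
  have t: "0 < t" using s K' by (simp add: t_def)
  have s_le: "4 * K' * M * s \<le> r\<^sup>2"
  proof -
    have "s \<le> r\<^sup>2 / (4 * K' * M + 1)" by (simp add: s_def)
    then have "s * (4 * K' * M + 1) \<le> r\<^sup>2" using p by (simp add: pos_le_divide_eq)
    then show ?thesis using s(1) by (simp add: algebra_simps)
  qed
  have budget: "K' * t + K' * M * ((s / r)\<^sup>2 / (1 - s / r)) \<le> s"
  proof -
    have "s / r \<le> 1 / 2" using s r by (simp add: field_simps)
    then have half: "1 / 2 \<le> 1 - s / r" "0 < 1 - s / r" by linarith+
    have "(s / r)\<^sup>2 / (1 - s / r) \<le> (s / r)\<^sup>2 / (1 / 2)"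
      by (rule divide_left_mono[OF half(1) zero_le_power2 mult_pos_pos[OF half(2)]]) simp
    then have "K' * M * ((s / r)\<^sup>2 / (1 - s / r)) \<le> K' * M * (2 * (s / r)\<^sup>2)"
      using K' M by (intro mult_left_mono) auto
    also have "\<dots> = (4 * K' * M * s) * (s / (2 * r\<^sup>2))"
      by (simp add: power_divide power2_eq_square)
    also have "\<dots> \<le> r\<^sup>2 * (s / (2 * r\<^sup>2))" using s_le s by (intro mult_right_mono) auto
    also have "\<dots> = s / 2" using r by simp
    finally have "K' * M * ((s / r)\<^sup>2 / (1 - s / r)) \<le> s / 2" .
    moreover have "K' * t = s / 2" using K' by (simp add: t_def)
    ultimately show ?thesis by linarith
  qed
  define X where "X = (\<lambda>n. {ps \<in> compositions_of n. 2 \<le> length ps})"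
  have finX: "finite (X n)" for n unfolding X_def using finite_compositions_of by simp
  have b_le: "norm (b hs) \<le> K' * (M * (\<Sum>ps\<in>X (length hs). prod_list (map (\<lambda>p. a p / r) ps))) * prod_list (map norm hs)"
    if n: "2 \<le> length hs" and a0: "\<And>p. 0 \<le> a p"
      and a: "\<And>gs. gs \<noteq> [] \<Longrightarrow> length gs < length hs \<Longrightarrow> norm (b gs) \<le> a (length gs) * prod_list (map norm gs)"
    for hs a
  proof -
    define T where "T = (\<lambda>hs. \<Sum>ps\<in>X (length hs). c (map b (blocks ps hs)))"
    have split: "formal_comp c b gs = c [b gs] + T gs" if "length gs = length hs" for gs
    proof -
      have "compositions_of (length gs) = insert [length gs] (X (length gs))"
        unfolding X_def by (rule compositions_of_eq_insert) (use n that in linarith)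
      moreover have "[length gs] \<notin> X (length gs)" by (simp add: X_def)
      ultimately show ?thesis using finX[of "length gs"] by (simp add: formal_comp_def T_def)
    qed
    have lin: "linear (\<lambda>x. c [x])"
      using multilinear_Cons_add[of "[]" c] multilinear_Cons_scaleR[of "[]" c] cm by (intro linearI) auto
    have "0 = symmetrize (formal_comp c b) hs" using inv[OF n] by simp
    also have "\<dots> = symmetrize (\<lambda>gs. c [b gs] + T gs) hs" by (rule symmetrize_cong) (rule split)
    also have "\<dots> = c [symmetrize b hs] + symmetrize T hs"
      unfolding symmetrize_add symmetrize_linear[OF lin] ..
    also have "symmetrize b hs = b hs" by (rule symmetrize_symmetric[OF sym])
    finally have "c [b hs] = - symmetrize T hs" by (simp add: eq_neg_iff_add_eq_0)
    then have "b hs = b [- symmetrize T hs]" using bc[of "b hs"] by simp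
    then have "norm (b hs) \<le> K' * norm (symmetrize T hs)" using bK'[of "- symmetrize T hs"] by simp
    also have "norm (symmetrize T hs)
        \<le> (M * (\<Sum>ps\<in>X (length hs). prod_list (map (\<lambda>p. a p / r) ps))) * prod_list (map norm hs)"
    proof (rule symmetrize_norm_le)
      fix cs :: "'b list" assume len: "length cs = length hs"
      have "norm (T cs) \<le> (\<Sum>ps\<in>X (length cs). M * prod_list (map (\<lambda>p. a p / r) ps) * prod_list (map norm cs))"
        unfolding T_def
      proof (rule sum_norm_le)
        fix ps assume ps: "ps \<in> X (length cs)"
        have parts: "0 < p \<and> p < length hs" if "p \<in> set ps" for p
        proof -
          obtain xs ys where xy: "ps = xs @ p # ys" using split_list[OF \<open>p \<in> set ps\<close>] by blast
          have ps': "0 \<notin> set ps" "sum_list ps = length hs" "2 \<le> length ps"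
            using ps len by (auto simp: X_def compositions_of_def)
          have "length xs \<le> sum_list xs" "length ys \<le> sum_list ys" "0 < p"
            using ps'(1) xy by (auto intro!: length_le_sum_list gr0I)
          then show ?thesis using ps'(2,3) xy by simp
        qed
        show "norm (c (map b (blocks ps cs))) \<le> M * prod_list (map (\<lambda>p. a p / r) ps) * prod_list (map norm cs)"
        proof (rule norm_formal_comp_term_le[OF c M r])
          show "norm (b gs) \<le> a (length gs) * prod_list (map norm gs)" if "length gs \<in> set ps" for gs
            using parts[OF that] by (intro a) auto
          show "length cs = sum_list ps" using ps by (simp add: X_def compositions_of_def)
        qed (rule a0)
      qed
      also have "\<dots> = (M * (\<Sum>ps\<in>X (length hs). prod_list (map (\<lambda>p. a p / r) ps))) * prod_list (map norm cs)"
        unfolding sum_distrib_left sum_distrib_right len ..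
      finally show "norm (T cs) \<le> (M * (\<Sum>ps\<in>X (length hs). prod_list (map (\<lambda>p. a p / r) ps))) * prod_list (map norm cs)" .
    qed
    finally show ?thesis using K' by (simp add: mult_ac)
  qed
  have scale: "prod_list (map (\<lambda>p. a p / r) ps) * t ^ sum_list ps = prod_list (map (\<lambda>p. a p * t ^ p / r) ps)"
    for a :: "nat \<Rightarrow> real" and ps
    by (induction ps) (auto simp: power_add mult_ac)
  have majorant: "\<exists>a. (\<forall>p. 0 \<le> a p) \<and> (\<forall>n. (\<Sum>p=1..n. a p * t ^ p) \<le> s)
      \<and> (\<forall>hs. hs \<noteq> [] \<and> length hs \<le> N \<longrightarrow> norm (b hs) \<le> a (length hs) * prod_list (map norm hs))" for N
  proof (induction N)
    case 0
    then show ?case using s by (intro exI[of _ "\<lambda>_. 0"]) auto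
  next
    case (Suc N)
    then obtain a where a0: "\<And>p. 0 \<le> a p" and as: "\<And>n. (\<Sum>p=1..n. a p * t ^ p) \<le> s"
      and ab: "\<And>hs. hs \<noteq> [] \<Longrightarrow> length hs \<le> N \<Longrightarrow> norm (b hs) \<le> a (length hs) * prod_list (map norm hs)"
      by blast
    \<comment> \<open>The recursion is used in every degree, also beyond \<open>Suc N\<close>, where \<open>a'\<close> bounds nothing yet: the
      estimate of its generating sum does not depend on the degree.\<close>
    define a' where "a' = (\<lambda>n. if n = 1 then K' else K' * (M * (\<Sum>ps\<in>X n. prod_list (map (\<lambda>p. a p / r) ps))))"
    define w where "w = (\<lambda>p. a p * t ^ p / r)"
    have pos: "0 \<le> prod_list (map (\<lambda>p. a p / r) ps)" for ps
      using a0 r by (intro prod_list_nonneg_real) auto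
    have "0 \<le> a' p" for p using K' M pos by (simp add: a'_def sum_nonneg)
    moreover have "(\<Sum>p=1..n. a' p * t ^ p) \<le> s" for n
    proof (cases "n = 0")
      case False
      have w0: "0 \<le> w p" for p using a0[of p] r t by (simp add: w_def)
      have W: "(\<Sum>p=1..n. w p) \<le> s / r" for n
        unfolding w_def sum_divide_distrib[symmetric] using as[of n] r by (intro divide_right_mono) auto
      have "{1..n} = insert 1 {2..n}" using False by auto
      then have "(\<Sum>p=1..n. a' p * t ^ p) = K' * t + (\<Sum>p=2..n. a' p * t ^ p)"
        by (simp add: a'_def)
      also have "(\<Sum>p=2..n. a' p * t ^ p) = (\<Sum>p=2..n. K' * M * (\<Sum>ps\<in>X p. prod_list (map w ps)))"
      proof (rule sum.cong[OF refl])
        fix p assume p: "p \<in> {2..n}"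
        have "(\<Sum>ps\<in>X p. prod_list (map (\<lambda>p. a p / r) ps)) * t ^ p = (\<Sum>ps\<in>X p. prod_list (map w ps))"
          unfolding sum_distrib_right w_def scale[symmetric]
          by (rule sum.cong) (auto simp: X_def compositions_of_def)
        then show "a' p * t ^ p = K' * M * (\<Sum>ps\<in>X p. prod_list (map w ps))"
          using p by (simp add: a'_def mult.assoc)
      qed
      also have "\<dots> = K' * M * (\<Sum>ps\<in>(\<Union>p\<in>{2..n}. X p). prod_list (map w ps))"
      proof -
        have "(\<Sum>ps\<in>(\<Union>p\<in>{2..n}. X p). prod_list (map w ps)) = (\<Sum>p=2..n. \<Sum>ps\<in>X p. prod_list (map w ps))"
          by (rule sum.UNION_disjoint) (auto simp: finX, auto simp: X_def compositions_of_def)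
        then show ?thesis by (simp add: sum_distrib_left)
      qed
      also have "\<dots> \<le> K' * M * ((s / r)\<^sup>2 / (1 - s / r))"
      proof (rule mult_left_mono)
        show "(\<Sum>ps\<in>(\<Union>p\<in>{2..n}. X p). prod_list (map w ps)) \<le> (s / r)\<^sup>2 / (1 - s / r)"
        proof (rule sum_prod_list_le[OF w0 W])
          show "s / r < 1" using s r by (simp add: field_simps)
        qed (auto simp: finX, auto simp: X_def compositions_of_def)
      qed (use K' M in auto)
      finally show ?thesis using budget by linarith
    qed (use s in auto)
    moreover have "norm (b hs) \<le> a' (length hs) * prod_list (map norm hs)" if "hs \<noteq> []" "length hs \<le> Suc N" for hs
    proof (cases "length hs = 1")
      case True
      then obtain x where "hs = [x]" by (auto simp: length_Suc_conv)
      then show ?thesis using bK'[of x] by (simp add: a'_def)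
    next
      case False
      then have "2 \<le> length hs" using that by (cases hs) (auto simp: Suc_le_eq)
      then have "norm (b hs)
          \<le> K' * (M * (\<Sum>ps\<in>X (length hs). prod_list (map (\<lambda>p. a p / r) ps))) * prod_list (map norm hs)"
      proof (rule b_le[where a = a])
        fix gs :: "'b list" assume "gs \<noteq> []" "length gs < length hs"
        then show "norm (b gs) \<le> a (length gs) * prod_list (map norm gs)"
          using that by (intro ab) auto
      qed (rule a0)
      then show ?thesis unfolding a'_def using False by (simp only: if_False)
    qed
    ultimately show ?case by blast
  qed
  have "norm (b hs) \<le> s / t ^ length hs * prod_list (map norm hs)" for hs
  proof (cases "hs = []")
    case True
    then show ?thesis using s b0 by simp
  next
    case False
    let ?n = "length hs"
    obtain a where a: "\<And>p. 0 \<le> a p" "\<And>n. (\<Sum>p=1..n. a p * t ^ p) \<le> s"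
      "norm (b hs) \<le> a ?n * prod_list (map norm hs)"
      using majorant[of ?n] False by blast
    have "?n \<in> {1..?n}" using False by (simp add: Suc_le_eq)
    then have "a ?n * t ^ ?n \<le> (\<Sum>p=1..?n. a p * t ^ p)"
      using a(1) t by (intro member_le_sum) auto
    then have "a ?n \<le> s / t ^ ?n" using a(2)[of ?n] t by (simp add: pos_le_divide_eq)
    from mult_right_mono[OF this prod_norm_nonneg[of hs]] show ?thesis using a(3) by linarith
  qed
  then show ?thesis using t by blast
qed

text \<open>The formal inverse \<open>b\<close> converges to a germ \<open>H\<close>, and the expansions of \<open>F \<circ> H\<close> and \<open>H \<circ> F\<close> are the two
  formal compositions, whose symmetrizations are the series of the identity. Equal power series have
  equal sums.\<close>

lemma germ_comp_invertible_if_sym_comp_invertible: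
  fixes F :: "'b::complex_banach_algebra \<Rightarrow> 'b"
  assumes F: "analytic_near_0 F" and inv: "sym_comp_invertible (mfs F)"
  shows "germ_comp_invertible F"
proof -
  obtain c M r where c: "power_series F 0 c M r" "\<And>n. symmetric_fn n c" "mfs F = (\<lambda>hs. of_B (c hs))"
    using analytic_near_0_expansion[OF F] by blast
  have "mfs F [] = 0" using inv unfolding sym_comp_invertible_def by blast
  then have "c [] = 0" unfolding c(3) of_B_0[symmetric] by simp
  then have F0: "F 0 = 0" using power_series_coeff_Nil[OF c(1)] by simp
  obtain \<beta> where \<beta>: "\<beta> \<in> SymMul" "\<beta> [] = 0" "mfs F \<circ>\<^sub>s \<beta> = series_id" "\<beta> \<circ>\<^sub>s mfs F = series_id"
    using inv unfolding sym_comp_invertible_def by blast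
  have "\<beta> [] = of_B 0" using \<beta>(2) by (simp add: of_B_0)
  from SymMul_of_B[OF \<beta>(1) this] obtain b where
    b: "\<beta> = (\<lambda>hs. of_B (b hs))" "\<And>n. multilinear n b" "\<And>n. symmetric_fn n b"
    by blast
  have b0: "b [] = 0" using \<beta>(2) unfolding b(1) of_B_0[symmetric] by simp
  have cb: "symmetrize (formal_comp c b) hs = (if length hs = 1 then hs ! 0 else 0)"
    and bc: "symmetrize (formal_comp b c) hs = (if length hs = 1 then hs ! 0 else 0)" for hs
  proof -
    have "of_B (symmetrize (formal_comp c b) hs) = series_id hs"
      "of_B (symmetrize (formal_comp b c) hs) = series_id hs"
      using fun_cong[OF \<beta>(3), of hs] fun_cong[OF \<beta>(4), of hs] unfolding c(3) b(1) sym_comp_of_B by auto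
    then show "symmetrize (formal_comp c b) hs = (if length hs = 1 then hs ! 0 else 0)"
      "symmetrize (formal_comp b c) hs = (if length hs = 1 then hs ! 0 else 0)"
      unfolding series_id_def of_B_0[symmetric] by (auto split: if_splits)
  qed
  have op1: "compositions_of (Suc 0) = {[Suc 0]}"
  proof -
    have "{ps \<in> compositions_of (Suc 0). 2 \<le> length ps} = {}"
      using length_le_sum_list by (fastforce simp: compositions_of_def)
    then show ?thesis using compositions_of_eq_insert[of "Suc 0"] by (simp only: zero_less_Suc simp_thms)
  qed
  have linear_term: "symmetrize (formal_comp f g) [x] = f [g [x]]" for f g :: "'b list \<Rightarrow> 'b" and x
    using symmetrize_replicate[of "formal_comp f g" 1 x] by (simp add: formal_comp_def op1)
  have cb1: "c [b [x]] = x" and bc1: "b [c [x]] = x" for x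
    using cb[of "[x]"] bc[of "[x]"] unfolding linear_term by auto
  have "linear (\<lambda>x. b [x])"
    using multilinear_Cons_add[of "[]" b] multilinear_Cons_scaleR[of "[]" b] b(2) by (intro linearI) auto
  from linear_inverse_bounded[OF power_series_linear_term[OF c(1)] this cb1 bc1]
  obtain K where K: "\<And>x. norm (b [x]) \<le> K * norm x" by blast
  obtain D \<rho> where "0 < \<rho>" "\<And>hs. norm (b hs) \<le> D / \<rho> ^ length hs * prod_list (map norm hs)"
    using formal_comp_inverse_bound[OF power_series_norm_le[OF c(1)] power_series_radius_pos[OF c(1)]
      power_series_multilinear[OF c(1)] b(3) b0 _ bc1 K] cb by auto
  from power_series_of_coefficients[OF b(2) this]
  obtain H where H: "power_series H 0 b D \<rho>" by blast
  have H0: "H 0 = 0" using power_series_coeff_Nil[OF H] b0 by simp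
  have id_sums: "(\<lambda>n. if length (replicate n h) = 1 then replicate n h ! 0 else 0) sums h" for h :: 'b
  proof -
    have "(\<lambda>n. if length (replicate n h) = 1 then replicate n h ! 0 else 0) = (\<lambda>n. if n = 1 then h else 0)"
      by auto
    then show ?thesis using sums_single[of 1 "\<lambda>_. h"] by simp
  qed
  have "power_series F (H 0) c M r" "power_series H (F 0) b D \<rho>" using c(1) H F0 H0 by simp_all
  then obtain \<rho>1 \<rho>2 where FH: "power_series (\<lambda>x. F (H x)) 0 (formal_comp c b) (2 * M) \<rho>1"
    and HF: "power_series (\<lambda>x. H (F x)) 0 (formal_comp b c) (2 * D) \<rho>2"
    using power_series_compose[OF _ H] power_series_compose[OF _ c(1)] by blast
  have "\<forall>\<^sub>F h in nhds 0. F (H h) = h"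
    using power_series_eventually_eqI[OF power_series_symmetrize[OF FH], of "\<lambda>h. h"] id_sums
    unfolding cb by blast
  moreover have "\<forall>\<^sub>F h in nhds 0. H (F h) = h"
    using power_series_eventually_eqI[OF power_series_symmetrize[OF HF], of "\<lambda>h. h"] id_sums
    unfolding bc by blast
  ultimately have "\<forall>\<^sub>F h in nhds 0. F (H h) = h \<and> H (F h) = h" by (rule eventually_conj)
  then show ?thesis
    unfolding germ_comp_invertible_def using power_series_imp_analytic_near_0[OF H] F0 H0 by blast
qed

theorem proposition3p6:
  fixes F G :: "'b::complex_banach_algebra \<Rightarrow> 'b"
  assumes "analytic_near_0 F" and "analytic_near_0 G"
  shows "(analytic_near_0 (\<lambda>b. F b + G b) \<and> mfs (\<lambda>b. F b + G b) = mfs F +\<^sub>f mfs G)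
    \<and> (analytic_near_0 (\<lambda>b. F b * G b) \<and> mfs (\<lambda>b. F b * G b) = mfs F \<cdot>\<^sub>s mfs G)
    \<and> (G 0 = 0 \<longrightarrow>
         analytic_near_0 (\<lambda>b. F (G b)) \<and> mfs (\<lambda>b. F (G b)) = mfs F \<circ>\<^sub>s mfs G)
    \<and> (sym_mult_invertible (mfs F) \<longrightarrow> germ_mult_invertible F)
    \<and> (sym_comp_invertible (mfs F) \<longrightarrow> germ_comp_invertible F)"
  using mfs_add[OF assms] mfs_mult[OF assms] mfs_compose[OF assms]
    germ_mult_invertible_if_sym_mult_invertible[OF assms(1)]
    germ_comp_invertible_if_sym_comp_invertible[OF assms(1)]
  by (intro conjI impI)

end
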